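(* Let $q$ be a complex number with $|q|<1$. Then the following four identities hold: \begin{align*} &\sum_{n,m\geq 0}\frac{(-1)^{\binom{n-m}{2}}q^{\frac{3m^2}{4}+\frac{mn}{2}+\frac{3n^2}{4}}}{(q;q)_m(q;q)_n}=\frac{1}{\bigl(q^2,q^8;q^{10}\bigr)_{\infty}},\\ &\sum_{n,m\geq 0}\frac{(-1)^{\binom{n-m}{2}}q^{\frac{3m^2}{4}+\frac{mn}{2}+\frac{3n^2}{4}+m+n}}{(q;q)_m(q;q)_n}=\frac{1}{\bigl(q^4,q^6;q^{10}\bigr)_{\infty}},\\ &\sum_{n,m\geq 0}\frac{(-1)^mq^{\frac{m^2}{4}+\frac{mn}{2}+\frac{n^2}{4}}}{\bigl(q^2;q^2\bigr)_m\bigl(q^2;q^2\bigr)_n} =\frac{1}{\bigl(-q^2;q^2\bigr)_{\infty}\bigl(q,q^4;q^5\bigr)_{\infty}},\\ &\sum_{n,m\geq 0}\frac{(-1)^mq^{\frac{m^2}{4}+\frac{mn}{2}+\frac{n^2}{4}+m+n}}{\bigl(q^2;q^2\bigr)_m\bigl(q^2;q^2\bigr)_n} =\frac{1}{\bigl(-q^2;q^2\bigr)_{\infty}\bigl(q^2,q^3;q^5\bigr)_{\infty}}, \end{align*} where the sums run over all pairs of nonnegative integers $(n,m)$.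
   Context: Standard $q$-Pochhammer notation: $(a;q)_0=1$, $(a;q)_n=\prod_{k=0}^{n-1}(1-aq^k)$ for $n\ge1$, $(a;q)_\infty=\prod_{k=0}^{\infty}(1-aq^k)$, and $(a_1,\dots,a_m;q)_n=(a_1;q)_n\cdots(a_m;q)_n$ for $n\in\mathbb{N}\cup\{\infty\}$. For an integer $k$ (possibly negative), $\binom{k}{2}=k(k-1)/2$. Fractional powers of $q$ are taken with respect to a fixed choice of $q^{1/4}$ (with $q^{a/4}=(q^{1/4})^a$ for integers $a$); equivalently the identities may be read as identities of formal power series in $q^{1/4}$. *)

theory Defs
  imports "HOL-Analysis.Analysis"
begin

definition qpoch :: "complex \<Rightarrow> complex \<Rightarrow> nat \<Rightarrow> complex" where
  "qpoch a q n = (\<Prod>k<n. 1 - a * q ^ k)"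

definition qpoch_inf :: "complex \<Rightarrow> complex \<Rightarrow> complex" where
  "qpoch_inf a q = (\<Prod>k. 1 - a * q ^ k)"

definition qpochs_inf :: "complex list \<Rightarrow> complex \<Rightarrow> complex" where
  "qpochs_inf as q = (\<Prod>a\<leftarrow>as. qpoch_inf a q)"

text \<open>The binomial coefficient ``\<open>k\<close> choose 2'' for a possibly negative integer \<open>k\<close>;
  the division is exact and the value is never negative.\<close>

definition int_choose_two :: "int \<Rightarrow> int" where
  "int_choose_two k = k * (k - 1) div 2"

end

theory Submission
  imports Defs
begin

text \<open>
  Group each double series by \<open>N = n + m\<close>. In the first two the terms with \<open>N\<close> odd cancel in pairs,
  and for \<open>N = 2 K\<close> the inner sum is Gauss' alternating sum
  \<open>\<Sum>\<^sub>j (-1)\<^sup>j q\<^bsup>j\<^sup>2\<^esup> / ((q;q)\<^bsub>K-j\<^esub> (q;q)\<^bsub>K+j\<^esub>) = 1 / (q\<^sup>2;q\<^sup>2)\<^sub>K\<close>; what remains are the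
  Rogers--Ramanujan identities in base \<open>q\<^sup>2\<close>. In the last two the inner sum
  \<open>\<Sum>\<^sub>m (-1)\<^sup>m / ((q\<^sup>2;q\<^sup>2)\<^sub>m (q\<^sup>2;q\<^sup>2)\<^bsub>N-m\<^esub>)\<close> again vanishes for odd \<open>N\<close> and is \<open>1 / (q\<^sup>4;q\<^sup>4)\<^sub>k\<close>
  for \<open>N = 2 k\<close>. Multiplying by \<open>(-q\<^sup>2;q\<^sup>2)\<^sub>\<infinity>\<close> and expanding \<open>(-q\<^bsup>2k+2\<^esup>;q\<^sup>2)\<^sub>\<infinity>\<close> by Euler's theorem
  gives a double series which, regrouped along antidiagonals, is the Rogers--Ramanujan series in
  base \<open>q\<close>.

  The Rogers--Ramanujan identities follow by applying the limiting Bailey lemma twice to the unit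
  Bailey pair (relative to \<open>a = q\<^sup>e\<close>, \<open>e \<in> {0, 1}\<close>), letting \<open>N \<rightarrow> \<infinity>\<close>, and using the Jacobi triple
  product. All the finite identities reduce to recurrences for sums of the form
  \<open>\<Sum>\<^sub>j a\<^sub>j / ((q;q)\<^bsub>M-j\<^esub> (q;q)\<^bsub>N+j\<^esub>)\<close>.
\<close>

section \<open>Analytic preliminaries\<close>

text \<open>Dominated convergence for unordered sums. By the Weierstrass M-test the finite partial
  sums of \<open>f n\<close> converge to \<open>infsum (f n) UNIV\<close> uniformly in
  \<open>n\<close>, so the limit in \<open>n\<close> and the limit over finite sets can be
  exchanged.\<close>

lemma tendsto_infsum_dominated:
  fixes f :: "nat \<Rightarrow> 'a \<Rightarrow> complex"
  assumes bound: "\<And>n x. norm (f n x) \<le> M x" and M: "M summable_on UNIV"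
    and lim: "\<And>x. (\<lambda>n. f n x) \<longlonglongrightarrow> g x"
  shows "(\<lambda>n. infsum (f n) UNIV) \<longlonglongrightarrow> infsum g UNIV"
proof (rule swap_uniform_limit'[where f = "\<lambda>X n. \<Sum>x\<in>X. f n x" and g = "\<lambda>X. sum g X"
        and F = "finite_subsets_at_top UNIV" and S = UNIV])
  have f: "(\<lambda>x. f n x) summable_on UNIV" for n
    using bound by (intro abs_summable_summable[OF summable_on_comparison_test[OF M]]) auto
  have "norm (g x) \<le> M x" for x
    using LIMSEQ_le_const2[OF tendsto_norm[OF lim]] bound by blast
  then have "g summable_on UNIV"
    by (intro abs_summable_summable[OF summable_on_comparison_test[OF M]]) auto
  then show "(sum g \<longlongrightarrow> infsum g UNIV) (finite_subsets_at_top UNIV)"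
    by (rule infsum_tendsto)
  show "\<forall>\<^sub>F X in finite_subsets_at_top UNIV. (\<lambda>n. \<Sum>x\<in>X. f n x) \<longlonglongrightarrow> sum g X"
    by (intro always_eventually allI tendsto_sum lim)
  show "uniform_limit UNIV (\<lambda>X n. \<Sum>x\<in>X. f n x) (\<lambda>n. infsum (f n) UNIV)
      (finite_subsets_at_top UNIV)"
    by (rule Weierstrass_m_test_general'[where M = M])
       (use bound f M in \<open>auto intro: has_sum_infsum\<close>)
qed auto

section \<open>Triangular exponents and q-Pochhammer products\<close>

lemma int_choose_two_double: "2 * int_choose_two k = k * (k - 1)"
  unfolding int_choose_two_def by (rule dvd_mult_div_cancel) auto

lemma int_choose_two_add1: "int_choose_two (k + 1) = int_choose_two k + k"
  using int_choose_two_double[of k] int_choose_two_double[of "k + 1"] by (simp add: algebra_simps)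

lemma qpoch_Suc: "qpoch a q (Suc n) = qpoch a q n * (1 - a * q ^ n)"
  by (simp add: qpoch_def)

lemma qpoch_0 [simp]: "qpoch a q 0 = 1"
  by (simp add: qpoch_def)

lemma power_neq_one_of_norm_less:
  assumes "norm (q::complex) < 1" "n > 0" shows "q ^ n \<noteq> 1"
proof -
  have "norm (q ^ n) < 1" using assms by (simp add: norm_power power_less_one_iff)
  then show ?thesis by auto
qed

lemma qpoch_nonzero:
  assumes "norm q < 1" "norm a < 1" shows "qpoch a q n \<noteq> 0"
proof -
  have "norm (a * q ^ k) < 1" for k
  proof -
    have "norm a * norm q ^ k \<le> norm a * 1"
      using assms by (intro mult_left_mono power_le_one) auto
    then show ?thesis using assms by (simp add: norm_mult norm_power)
  qed
  then have "1 - a * q ^ k \<noteq> 0" for k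
    using norm_one less_irrefl[of "1::real"] by (metis eq_iff_diff_eq_0)
  then show ?thesis by (simp add: qpoch_def)
qed

lemma qpoch_inf_convergent:
  fixes a q :: complex
  assumes "norm q < 1"
  shows "convergent_prod (\<lambda>k. 1 - a * q ^ k)"
proof -
  have "summable (\<lambda>k. norm (a * q ^ k))"
    using assms by (simp add: norm_mult norm_power summable_mult)
  then have "summable (\<lambda>k. norm ((1 - a * q ^ k) - 1))"
    by simp
  then show ?thesis
    by (intro abs_convergent_prod_imp_convergent_prod summable_imp_abs_convergent_prod)
qed

lemma qpoch_tendsto:
  assumes "norm q < 1"
  shows "qpoch a q \<longlonglongrightarrow> qpoch_inf a q"
  using convergent_prod_LIMSEQ[OF qpoch_inf_convergent[OF assms, of a]]
  unfolding qpoch_def[abs_def] qpoch_inf_def LIMSEQ_lessThan_iff_atMost .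

lemma qpoch_inf_nonzero:
  assumes "norm q < 1" "norm a < 1"
  shows "qpoch_inf a q \<noteq> 0"
  unfolding qpoch_inf_def
proof (rule prodinf_nonzero[OF qpoch_inf_convergent[OF assms(1)]])
  fix k
  show "1 - a * q ^ k \<noteq> 0"
    using qpoch_nonzero[OF assms, of "Suc k"] by (simp add: qpoch_Suc)
qed

lemma qpoch_inf_split:
  assumes "norm q < 1"
  shows "qpoch_inf a q = qpoch a q n * qpoch_inf (a * q ^ n) q"
proof -
  have "qpoch a q (m + n) = qpoch a q n * qpoch (a * q ^ n) q m" for m
    by (induction m) (simp_all add: qpoch_Suc power_add mult_ac)
  then have "(\<lambda>m. qpoch a q (m + n)) \<longlonglongrightarrow> qpoch a q n * qpoch_inf (a * q ^ n) q"
    using qpoch_tendsto[OF assms, of "a * q ^ n"] by (simp add: tendsto_mult_left)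
  moreover have "(\<lambda>m. qpoch a q (m + n)) \<longlonglongrightarrow> qpoch_inf a q"
    using qpoch_tendsto[OF assms] by (rule LIMSEQ_ignore_initial_segment)
  ultimately show ?thesis by (rule LIMSEQ_unique[rotated])
qed

text \<open>The factors 1 - q^i are sorted by i modulo 5. On partial products of length 5n this is
  an induction on n, and the limit is taken along that subsequence.\<close>

lemma qpoch_inf_quintisection:
  assumes "norm q < 1"
  shows "qpoch_inf q q = qpoch_inf q (q^5) * qpoch_inf (q^2) (q^5) * qpoch_inf (q^3) (q^5)
    * qpoch_inf (q^4) (q^5) * qpoch_inf (q^5) (q^5)"
proof -
  have q5: "norm (q ^ 5) < 1" using assms by (simp add: norm_power power_less_one_iff)
  have *: "qpoch q q (5 * n) = qpoch q (q^5) n * qpoch (q^2) (q^5) n * qpoch (q^3) (q^5) n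
    * qpoch (q^4) (q^5) n * qpoch (q^5) (q^5) n" for n
  proof (induction n)
    case (Suc n)
    have 5: "5 * Suc n = Suc (Suc (Suc (Suc (Suc (5 * n)))))" by simp
    define x where "x = (q ^ 5) ^ n"
    have "q * q ^ (5 * n) = q * x" "q * q ^ Suc (5 * n) = q^2 * x"
      "q * q ^ Suc (Suc (5 * n)) = q^3 * x" "q * q ^ Suc (Suc (Suc (5 * n))) = q^4 * x"
      "q * q ^ Suc (Suc (Suc (Suc (5 * n)))) = q^5 * x"
      by (simp_all only: power_mult x_def power_Suc) (simp_all add: eval_nat_numeral)
    then show ?case
      unfolding 5 qpoch_Suc Suc x_def[symmetric] by (simp only: mult_ac)
  qed simp
  have "(\<lambda>n. qpoch q q (5 * n)) \<longlonglongrightarrow> qpoch_inf q (q^5) * qpoch_inf (q^2) (q^5) * qpoch_inf (q^3) (q^5)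
    * qpoch_inf (q^4) (q^5) * qpoch_inf (q^5) (q^5)"
    unfolding * by (intro tendsto_mult qpoch_tendsto q5)
  moreover have "(\<lambda>n. qpoch q q (5 * n)) \<longlonglongrightarrow> qpoch_inf q q"
    using LIMSEQ_subseq_LIMSEQ[OF qpoch_tendsto[OF assms, of q], of "\<lambda>n. 5 * n"]
    by (simp add: o_def strict_mono_def)
  ultimately show ?thesis by (rule LIMSEQ_unique[rotated])
qed

section \<open>Finite convolutions of inverse q-factorials\<close>

text \<open>Setting \<open>1 / (q;q)\<^sub>k = 0\<close> for \<open>k < 0\<close> makes \<open>1 / (q;q)\<^bsub>k-1\<^esub> = (1 - q\<^sup>k) / (q;q)\<^sub>k\<close> valid for all
  integers \<open>k\<close>, so that sums over \<open>j\<close> need no explicit range and can be shifted freely.\<close>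

definition iqf :: "complex \<Rightarrow> int \<Rightarrow> complex" where
  "iqf q k = (if k < 0 then 0 else 1 / qpoch q q (nat k))"

text \<open>For \<open>N = M + e\<close> this is the bilateral form of the Bailey pair relation
  relative to q^e, up to the constant (q;q)_e; for \<open>N = 0\<close> it is an ordinary
  convolution over 0 \<le> j \<le> M. Two separate indices are kept because shifting j only moves
  weight between them, with \<open>M + N\<close> fixed.\<close>

definition qconv :: "complex \<Rightarrow> (int \<Rightarrow> complex) \<Rightarrow> int \<Rightarrow> int \<Rightarrow> complex" where
  "qconv q a M N = (\<Sum>\<^sub>\<infinity>j. a j * iqf q (M - j) * iqf q (N + j))"

lemma iqf_neg [simp]: "k < 0 \<Longrightarrow> iqf q k = 0"
  and iqf_0 [simp]: "iqf q 0 = 1"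
  and iqf_of_nat: "iqf q (int n) = 1 / qpoch q q n"
  by (simp_all add: iqf_def)

lemma iqf_pred:
  assumes "norm q < 1"
  shows "(1 - q powi k) * iqf q k = iqf q (k - 1)"
proof (cases "k > 0")
  case True
  then obtain n where n: "k = int (Suc n)" by (metis pos_int_cases Suc_pred)
  then have "k - 1 = int n" by simp
  then show ?thesis
    using power_neq_one_of_norm_less[OF assms, of "Suc n"] qpoch_nonzero[OF assms assms, of n]
    unfolding n by (simp only: iqf_of_nat power_int_of_nat qpoch_Suc)
      (simp add: field_simps)
\<comment> \<open>At \<open>k = 0\<close> the factor 1 - q^0 vanishes, in agreement with
  \<open>iqf q (- 1) = 0\<close>.\<close>
qed (cases "k = 0"; simp)

lemma iqf_tendsto:
  assumes "norm q < 1"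
  shows "(\<lambda>n. iqf q (int n + k)) \<longlonglongrightarrow> 1 / qpoch_inf q q"
proof -
  have "(\<lambda>n. iqf q (int n)) \<longlonglongrightarrow> 1 / qpoch_inf q q"
    unfolding iqf_of_nat
    by (intro tendsto_divide tendsto_const qpoch_tendsto qpoch_inf_nonzero assms)
  moreover have "filterlim (\<lambda>n. nat (int n + k)) at_top sequentially"
    by (rule filterlim_at_top_mono[where f = "\<lambda>n. n - nat (- k)"])
       (auto simp: filterlim_minus_const_nat_at_top intro!: always_eventually)
  ultimately have "(\<lambda>n. iqf q (int (nat (int n + k)))) \<longlonglongrightarrow> 1 / qpoch_inf q q"
    by (rule filterlim_compose)
  \<comment> \<open>\<open>nat\<close> truncates only while n < -k, so the two sequences agree
    eventually.\<close>
  moreover have "\<forall>\<^sub>F n in sequentially. iqf q (int (nat (int n + k))) = iqf q (int n + k)"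
    using eventually_ge_at_top[of "nat (- k)"] by eventually_elim simp
  ultimately show ?thesis by (rule Lim_transform_eventually)
qed

lemma iqf_bounded:
  assumes "norm q < 1"
  obtains C where "C > 0" "\<And>k. norm (iqf q k) \<le> C"
proof -
  have "convergent (\<lambda>n. iqf q (int n))"
    using iqf_tendsto[OF assms, of 0] by (auto simp: convergent_def)
  then have "Bseq (\<lambda>n. iqf q (int n))" by (rule convergent_imp_Bseq)
  then obtain C where C: "C > 0" "\<And>n. norm (iqf q (int n)) \<le> C" by (auto elim: BseqE)
  have "norm (iqf q k) \<le> C" for k
    using C(2)[of "nat k"] C(1) by (cases "k < 0") auto
  with C(1) that show thesis by blast
qed

lemma qconv_summable: "(\<lambda>j. a j * iqf q (M - j) * iqf q (N + j)) summable_on UNIV"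
proof (rule finite_nonzero_values_imp_summable_on)
  have "{j \<in> UNIV. a j * iqf q (M - j) * iqf q (N + j) \<noteq> 0} \<subseteq> {- N..M}"
    by (auto simp: iqf_def split: if_splits)
  then show "finite {j \<in> UNIV. a j * iqf q (M - j) * iqf q (N + j) \<noteq> 0}"
    by (rule finite_subset) simp
qed

section \<open>Symmetries and recurrences of the convolutions\<close>

lemma infsum_int_shift: "(\<Sum>\<^sub>\<infinity>j. f (j + k)) = (\<Sum>\<^sub>\<infinity>j::int. f j)"
  by (rule infsum_reindex_bij_witness[of _ "\<lambda>j. j - k" "\<lambda>j. j + k"]) auto

lemma infsum_int_reflect: "(\<Sum>\<^sub>\<infinity>j. f (- j)) = (\<Sum>\<^sub>\<infinity>j::int. f j)"
  by (rule infsum_reindex_bij_witness[of _ "\<lambda>j. - j" "\<lambda>j. - j"]) auto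

lemma qconv_shift: "qconv q a M N = qconv q (\<lambda>j. a (j + k)) (M - k) (N + k)"
  unfolding qconv_def
  by (subst infsum_int_shift[of _ k, symmetric]) (simp add: algebra_simps)

lemma qconv_reflect: "qconv q a M N = qconv q (\<lambda>j. a (- j)) N M"
  unfolding qconv_def
  by (subst infsum_int_reflect[symmetric]) (simp add: mult_ac)

lemma qconv_cmult: "qconv q (\<lambda>j. k * a j) M N = k * qconv q a M N"
  unfolding qconv_def by (simp add: infsum_cmult_right' mult.assoc)

lemma qconv_neg: "M + N < 0 \<Longrightarrow> qconv q a M N = 0"
  unfolding qconv_def by (rule infsum_0) (auto simp: iqf_def)

lemma qconv_zero: "qconv q a 0 0 = a 0"
proof -
  have "qconv q a 0 0 = (\<Sum>\<^sub>\<infinity>j\<in>{0}. a j * iqf q (0 - j) * iqf q (0 + j))"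
    unfolding qconv_def by (rule infsum_cong_neutral) (auto simp: iqf_def)
  then show ?thesis by simp
qed

lemma qconv_conv_sum:
  "qconv q a (int N) 0 = (\<Sum>j\<le>N. a (int j) / (qpoch q q j * qpoch q q (N - j)))"
proof -
  have "qconv q a (int N) 0 = (\<Sum>\<^sub>\<infinity>j\<in>int ` {..N}. a j * iqf q (int N - j) * iqf q j)"
    unfolding qconv_def
  proof (rule infsum_cong_neutral)
    fix j assume "j \<in> UNIV - int ` {..N}"
    then have "j < 0 \<or> j > int N"
      by (metis Diff_iff atMost_iff image_eqI int_nat_eq linorder_not_less nat_le_iff)
    then show "a j * iqf q (int N - j) * iqf q (0 + j) = 0" by auto
  qed auto
  also have "\<dots> = (\<Sum>j\<le>N. a (int j) * iqf q (int N - int j) * iqf q (int j))"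
    by (simp add: sum.reindex)
  also have "\<dots> = (\<Sum>j\<le>N. a (int j) / (qpoch q q j * qpoch q q (N - j)))"
    by (intro sum.cong) (auto simp: iqf_of_nat simp flip: of_nat_diff)
  finally show ?thesis .
qed

text \<open>Obtained by multiplying the summand by
  \<open>1 - q\<^bsup>M+N\<^esup> = (1 - q\<^bsup>N+j\<^esup>) + q\<^bsup>N+j\<^esup> (1 - q\<^bsup>M-j\<^esup>)\<close>.\<close>

lemma qconv_split_right:
  assumes "q \<noteq> 0" "norm q < 1"
  shows "(1 - q powi (M + N)) * qconv q a M N
    = qconv q a M (N - 1) + qconv q (\<lambda>j. a j * q powi (N + j)) (M - 1) N"
proof -
  have "(1 - q powi (M + N)) * (a j * iqf q (M - j) * iqf q (N + j))
     = a j * iqf q (M - j) * iqf q (N - 1 + j)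
       + a j * q powi (N + j) * iqf q (M - 1 - j) * iqf q (N + j)" for j
  proof -
    have 1: "q powi (M + N) = q powi (N + j) * q powi (M - j)"
      using assms(1) by (simp add: power_int_add[symmetric] add.commute)
    have 2: "iqf q (N - 1 + j) = (1 - q powi (N + j)) * iqf q (N + j)"
      using iqf_pred[OF assms(2), of "N + j"] by (simp add: algebra_simps)
    have 3: "iqf q (M - 1 - j) = (1 - q powi (M - j)) * iqf q (M - j)"
      using iqf_pred[OF assms(2), of "M - j"] by (simp add: algebra_simps)
    show ?thesis unfolding 1 2 3 by (simp add: algebra_simps)
  qed
  then show ?thesis
    unfolding qconv_def infsum_cmult_right'[symmetric] infsum_add[OF qconv_summable qconv_summable, symmetric]
    by presburger
qed

text \<open>The mirror image of \<open>qconv_split_right\<close> under j -> -j.\<close>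

lemma qconv_split_left:
  assumes "q \<noteq> 0" "norm q < 1"
  shows "(1 - q powi (M + N)) * qconv q a M N
    = qconv q a (M - 1) N + qconv q (\<lambda>j. a j * q powi (M - j)) M (N - 1)"
proof -
  have "qconv q (\<lambda>j. a (- j) * q powi (M + j)) (N - 1) M
      = qconv q (\<lambda>j. a j * q powi (M - j)) M (N - 1)"
    by (subst qconv_reflect) simp
  moreover have "qconv q (\<lambda>j. a (- j)) N K = qconv q a K N" for K
    by (subst qconv_reflect) simp
  ultimately show ?thesis
    using qconv_split_right[OF assms, of N M "\<lambda>j. a (- j)"] by (simp add: add.commute)
qed

lemma powi_neq_one:
  assumes "norm (q::complex) < 1" "k > 0"
  shows "1 - q powi k \<noteq> 0"
  using power_neq_one_of_norm_less[OF assms(1), of "nat k"] assms(2)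
  by (simp add: power_int_def)

lemma neg_one_powi_add1: "(- 1 :: complex) powi (j + 1) = - ((- 1) powi j)"
  by (simp add: power_int_add)

lemma eq_inverse_of_mult:
  "x * g = 1 / p \<Longrightarrow> x \<noteq> 0 \<Longrightarrow> g = 1 / (p * x)" for x g p :: complex
  by (cases "p = 0") (auto simp: field_simps)

text \<open>Since q^k / (q;q)_k = 1 / (q;q)_k - 1 / (q;q)_(k-1), a weight q^(M-j) can be traded for
  a difference in \<open>M\<close>.\<close>

lemma qconv_weight_left:
  assumes "norm q < 1"
  shows "qconv q (\<lambda>j. a j * q powi (M - j)) M N = qconv q a M N - qconv q a (M - 1) N"
proof -
  have "a j * iqf q (M - j) * iqf q (N + j)
     = a j * iqf q (M - 1 - j) * iqf q (N + j)
       + a j * q powi (M - j) * iqf q (M - j) * iqf q (N + j)" for j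
  proof -
    have 3: "iqf q (M - 1 - j) = (1 - q powi (M - j)) * iqf q (M - j)"
      using iqf_pred[OF assms, of "M - j"] by (simp add: algebra_simps)
    show ?thesis unfolding 3 by (simp add: algebra_simps)
  qed
  then have "qconv q a M N = qconv q a (M - 1) N + qconv q (\<lambda>j. a j * q powi (M - j)) M N"
    unfolding qconv_def infsum_add[OF qconv_summable qconv_summable, symmetric] by presburger
  then show ?thesis by simp
qed

lemma qconv_weight_right:
  assumes "norm q < 1"
  shows "qconv q (\<lambda>j. a j * q powi (N + j)) M N = qconv q a M N - qconv q a M (N - 1)"
proof -
  have "qconv q (\<lambda>j. a j * q powi (N + j)) M N = qconv q (\<lambda>j. a (- j) * q powi (N - j)) N M"
    by (subst qconv_reflect) simp
  moreover have "qconv q (\<lambda>j. a (- j)) K M = qconv q a M K" for K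
    by (subst qconv_reflect) simp
  ultimately show ?thesis
    using qconv_weight_left[OF assms, of "\<lambda>j. a (- j)" N M] by simp
qed

lemma qconv_flip: "qconv q a N 0 = qconv q (\<lambda>j. a (N - j)) N 0"
  by (subst qconv_reflect, subst qconv_shift[of q _ _ _ "- N"]) simp

section \<open>The q-Vandermonde sum and the limiting Bailey lemma\<close>

text \<open>This is the q-Vandermonde sum with one upper index sent to infinity. Splitting off a
  factor on the left leaves the sum for \<open>M\<close> and, after t -> t + 1, q^(M+1+a) times the
  sum for \<open>M\<close> with parameter \<open>a + 1\<close>; hence \<open>a\<close> must stay
  arbitrary in the induction.\<close>

lemma q_Vandermonde:
  assumes q: "q \<noteq> 0" "norm q < 1"
  shows "qconv q (\<lambda>t. q powi (t * t + a * t) * iqf q (t + a)) (int M) 0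
    = iqf q (int M) * iqf q (int M + a)"
proof (induction M arbitrary: a)
  case 0
  show ?case by (simp add: qconv_zero)
next
  case (Suc M)
  let ?w = "\<lambda>a t. q powi (t * t + a * t) * iqf q (t + a)"
  have w: "?w a (t + 1) * q powi (int M - t) = q powi (int M + 1 + a) * ?w (a + 1) t" for t
  proof -
    have "(t + 1) * (t + 1) + a * (t + 1) + (int M - t)
        = (int M + 1 + a) + (t * t + (a + 1) * t)"
      by (simp add: algebra_simps)
    then have "q powi ((t + 1) * (t + 1) + a * (t + 1)) * q powi (int M - t)
        = q powi (int M + 1 + a) * q powi (t * t + (a + 1) * t)"
      using q(1) by (simp only: power_int_add[symmetric] simp_thms)
    then show ?thesis by (simp add: algebra_simps)
  qed
  have "(1 - q powi (int M + 1)) * qconv q (?w a) (int M + 1) 0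
     = qconv q (?w a) (int M) 0 + qconv q (\<lambda>t. ?w a t * q powi (int M + 1 - t)) (int M + 1) (- 1)"
    using qconv_split_left[OF q, of "int M + 1" 0 "?w a"] by simp
  also have "qconv q (\<lambda>t. ?w a t * q powi (int M + 1 - t)) (int M + 1) (- 1)
     = qconv q (\<lambda>t. q powi (int M + 1 + a) * ?w (a + 1) t) (int M) 0"
    by (subst qconv_shift[of q _ _ _ 1]) (simp add: w[symmetric])
  also have "\<dots> = q powi (int M + 1 + a) * (iqf q (int M) * iqf q (int M + 1 + a))"
    by (simp only: qconv_cmult Suc) (simp add: ac_simps)
  also have "qconv q (?w a) (int M) 0 = iqf q (int M) * iqf q (int M + a)" by (rule Suc)
  also have "iqf q (int M + a) = (1 - q powi (int M + 1 + a)) * iqf q (int M + 1 + a)"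
    using iqf_pred[OF q(2), of "int M + 1 + a"] by simp
  also have "iqf q (int M) = (1 - q powi (int M + 1)) * iqf q (int M + 1)"
    using iqf_pred[OF q(2), of "int M + 1"] by simp
  finally have "(1 - q powi (int M + 1)) * qconv q (?w a) (int M + 1) 0
     = (1 - q powi (int M + 1)) * (iqf q (int M + 1) * iqf q (int M + 1 + a))"
    by (simp add: algebra_simps)
  then show ?case
    using powi_neq_one[OF q(2), of "int M + 1"] by (simp add: add_ac)
qed

text \<open>The shift s -> s + j turns the left side into \<open>q_Vandermonde\<close> with upper
  index \<open>N - j\<close> and parameter \<open>2 * j + e\<close>; for \<open>j > N\<close> both
  sides vanish.\<close>

lemma Bailey_kernel:
  assumes q: "q \<noteq> 0" "norm q < 1"
  shows "(\<Sum>\<^sub>\<infinity>s. q powi (s * s + e * s) * iqf q (N - s) * (iqf q (s - j) * iqf q (s + e + j)))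
    = q powi (j * j + e * j) * iqf q (N - j) * iqf q (N + e + j)"
proof -
  have eq: "q powi ((s + j) * (s + j) + e * (s + j))
      = q powi (j * j + e * j) * q powi (s * s + (2 * j + e) * s)" for s
    using q(1) by (simp add: power_int_add[symmetric] algebra_simps)
  have "(\<Sum>\<^sub>\<infinity>s. q powi (s * s + e * s) * iqf q (N - s) * (iqf q (s - j) * iqf q (s + e + j)))
     = qconv q (\<lambda>s. q powi (s * s + e * s) * iqf q (s + e + j)) N (- j)"
    unfolding qconv_def by (rule infsum_cong) (simp add: mult_ac)
  also have "\<dots> = qconv q (\<lambda>s. q powi (j * j + e * j) *
      (q powi (s * s + (2 * j + e) * s) * iqf q (s + (2 * j + e)))) (N - j) 0"
    by (subst qconv_shift[of q _ _ _ j]) (simp only: eq, simp add: add_ac mult_ac)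
  also have "\<dots> = q powi (j * j + e * j) * iqf q (N - j) * iqf q (N + e + j)"
  proof (cases "j \<le> N")
    case True
    then obtain M where M: "N - j = int M" by (metis diff_ge_0_iff_ge nonneg_int_cases)
    show ?thesis
      unfolding qconv_cmult M q_Vandermonde[OF q] unfolding M[symmetric] by (simp add: algebra_simps)
  qed (simp add: qconv_cmult qconv_neg)
  finally show ?thesis .
qed

text \<open>Inserting the definition of \<beta> and exchanging the two sums leaves
  \<open>Bailey_kernel\<close> as the inner sum. In Bailey's terms, a pair (\<alpha>, \<beta>)
  produces a new pair whose \<alpha> carries the extra weight q^(j^2 + e j).\<close>

lemma Bailey_step:
  assumes q: "q \<noteq> 0" "norm q < 1" and e: "e \<in> {0, 1}"
    and \<beta>: "\<And>s. \<beta> s = qconv q \<alpha> s (s + e)"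
  shows "(\<Sum>\<^sub>\<infinity>s. q powi (s * s + e * s) * iqf q (N - s) * \<beta> s)
    = qconv q (\<lambda>j. \<alpha> j * q powi (j * j + e * j)) N (N + e)"
proof -
  let ?f = "\<lambda>s j. q powi (s * s + e * s) * iqf q (N - s)
      * (\<alpha> j * (iqf q (s - j) * iqf q (s + e + j)))"
  have "(\<lambda>(s, j). ?f s j) summable_on UNIV \<times> UNIV"
  proof (rule finite_nonzero_values_imp_summable_on)
    \<comment> \<open>A nonzero term needs -s - e \<le> j \<le> s \<le> N; comparing the two bounds
      on j gives 2s + e \<ge> 0, which bounds s from below.\<close>
    have "{x \<in> UNIV \<times> UNIV. (case x of (s, j) \<Rightarrow> ?f s j) \<noteq> 0} \<subseteq> {-1..N} \<times> {-N-1..N}"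
      using e by (auto simp: iqf_def split: if_splits)
    then show "finite {x \<in> UNIV \<times> UNIV. (case x of (s, j) \<Rightarrow> ?f s j) \<noteq> 0}"
      by (rule finite_subset) auto
  qed
  then have "(\<Sum>\<^sub>\<infinity>s. \<Sum>\<^sub>\<infinity>j. ?f s j) = (\<Sum>\<^sub>\<infinity>j. \<Sum>\<^sub>\<infinity>s. ?f s j)"
    by (rule infsum_swap_banach)
  moreover have "(\<Sum>\<^sub>\<infinity>j. ?f s j) = q powi (s * s + e * s) * iqf q (N - s) * \<beta> s" for s
    unfolding \<beta> qconv_def by (simp add: infsum_cmult_right' mult.assoc)
  moreover have "(\<Sum>\<^sub>\<infinity>s. ?f s j)
      = \<alpha> j * q powi (j * j + e * j) * iqf q (N - j) * iqf q (N + e + j)" for j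
  proof -
    have "(\<Sum>\<^sub>\<infinity>s. ?f s j) = \<alpha> j *
      (\<Sum>\<^sub>\<infinity>s. q powi (s * s + e * s) * iqf q (N - s) * (iqf q (s - j) * iqf q (s + e + j)))"
      by (subst infsum_cmult_right'[symmetric]) (simp add: mult_ac)
    then show ?thesis unfolding Bailey_kernel[OF q] by (simp add: mult_ac)
  qed
  ultimately show ?thesis by (simp add: qconv_def)
qed

section \<open>Finite triple product and finite Rogers--Ramanujan identities\<close>

text \<open>Quasi-periodicity of the theta weight. It lets the remainder in the splitting lemmas
  return to a multiple of the original sum.\<close>

lemma theta_weight_shift:
  assumes "q \<noteq> 0" "(z::complex) \<noteq> 0"
  shows "(- z) powi (j + 1) * q powi int_choose_two (j + 1)
    = - z * q powi j * ((- z) powi j * q powi int_choose_two j)"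
  using assms by (simp add: int_choose_two_add1 power_int_add)

lemma theta_weight_shift_down:
  assumes "q \<noteq> 0" "(z::complex) \<noteq> 0"
  shows "(- z) powi (j - 1) * q powi int_choose_two (j - 1) * q powi j
    = - (q / z) * ((- z) powi j * q powi int_choose_two j)"
  using theta_weight_shift[OF assms, of "j - 1"] assms
  by (simp add: power_int_diff field_simps)

text \<open>The indices are raised one at a time, (N, N) -> (N+1, N) -> (N+1, N+1). By
  quasi-periodicity the first half-step contributes 1 - z q^N and the second 1 - (q/z) q^N.\<close>

lemma finite_Jacobi_triple:
  assumes q: "q \<noteq> 0" "norm q < 1" and z: "z \<noteq> 0"
  shows "qconv q (\<lambda>j. (- z) powi j * q powi int_choose_two j) (int N) (int N)
    = iqf q (2 * int N) * qpoch z q N * qpoch (q / z) q N"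
proof (induction N)
  case 0
  show ?case by (simp add: qconv_zero int_choose_two_def)
next
  case (Suc N)
  let ?a = "\<lambda>j. (- z) powi j * q powi int_choose_two j"
  let ?n = "int N"
  let ?E = "qconv q ?a (?n + 1) ?n"
  have s1: "?a (j - 1) * q powi (?n + j) = - (q / z * q ^ N) * ?a j" for j
  proof -
    have "?a (j - 1) * q powi (?n + j) = q ^ N * (?a (j - 1) * q powi j)"
      using q(1) by (simp add: power_int_add)
    then show ?thesis
      unfolding theta_weight_shift_down[OF q(1) z, of j] by simp
  qed
  have s2: "?a (j + 1) * q powi (?n - j) = - (z * q ^ N) * ?a j" for j
    using theta_weight_shift[OF q(1) z, of j] q(1) by (simp add: power_int_diff)
  have "(1 - q powi (2 * ?n + 2)) * qconv q ?a (?n + 1) (?n + 1)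
      = ?E + qconv q (\<lambda>j. ?a j * q powi (?n + 1 + j)) ?n (?n + 1)"
    using qconv_split_right[OF q, of "?n + 1" "?n + 1" ?a] by (simp add: algebra_simps)
  also have "qconv q (\<lambda>j. ?a j * q powi (?n + 1 + j)) ?n (?n + 1)
      = qconv q (\<lambda>j. ?a (j - 1) * q powi (?n + j)) (?n + 1) ?n"
    by (subst qconv_shift[of q _ _ _ "- 1"]) simp
  also have "\<dots> = - (q / z * q ^ N) * ?E"
    unfolding s1 qconv_cmult ..
  finally have 1: "(1 - q powi (2 * ?n + 2)) * qconv q ?a (?n + 1) (?n + 1)
      = (1 - q / z * q ^ N) * ?E"
    by (simp add: algebra_simps)
  have "(1 - q powi (2 * ?n + 1)) * ?E
      = qconv q ?a ?n ?n + qconv q (\<lambda>j. ?a j * q powi (?n + 1 - j)) (?n + 1) (?n - 1)"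
    using qconv_split_left[OF q, of "?n + 1" "?n" ?a] by (simp add: algebra_simps)
  also have "qconv q (\<lambda>j. ?a j * q powi (?n + 1 - j)) (?n + 1) (?n - 1)
      = qconv q (\<lambda>j. ?a (j + 1) * q powi (?n - j)) ?n ?n"
    by (subst qconv_shift[of q _ _ _ 1]) simp
  also have "\<dots> = - (z * q ^ N) * qconv q ?a ?n ?n"
    unfolding s2 qconv_cmult ..
  finally have 2: "(1 - q powi (2 * ?n + 1)) * ?E
      = (1 - z * q ^ N) * qconv q ?a ?n ?n"
    by (simp add: algebra_simps)
  \<comment> \<open>The factors on the left of the two half-steps are exactly those separating
    \<open>iqf\<close> at 2N from \<open>iqf\<close> at 2N + 2.\<close>
  have 3: "iqf q (2 * ?n) = (1 - q powi (2 * ?n + 1)) * ((1 - q powi (2 * ?n + 2)) * iqf q (2 * ?n + 2))"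
    using iqf_pred[OF q(2), of "2 * ?n + 2"] iqf_pred[OF q(2), of "2 * ?n + 1"] by (simp add: add.commute)
  have nz: "1 - q powi (2 * ?n + 1) \<noteq> 0" "1 - q powi (2 * ?n + 2) \<noteq> 0"
    by (rule powi_neq_one[OF q(2)], simp)+
  define c1 c2 where "c1 = 1 - q powi (2 * ?n + 1)" and "c2 = 1 - q powi (2 * ?n + 2)"
  have "c1 * (c2 * qconv q ?a (?n + 1) (?n + 1)) = (1 - q / z * q ^ N) * (c1 * ?E)"
    using 1 by (simp add: c1_def c2_def)
  also have "\<dots> = c1 * (c2 * (iqf q (2 * ?n + 2) * qpoch z q (Suc N) * qpoch (q / z) q (Suc N)))"
    unfolding c1_def 2 Suc 3 c2_def qpoch_Suc by (simp only: mult_ac)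
  finally show ?case
    using nz unfolding c1_def[symmetric] c2_def[symmetric] by (simp add: add_ac)
qed

text \<open>For \<open>e = 0\<close> put z = 1 in the finite triple product: (1;q)_N contains the
  factor 1 - 1 once N > 0. For \<open>e = 1\<close> one split reduces to \<open>e = 0\<close> with
  the factor 1 - q^(N+1), which equals 1 - q^(2N+1) at N = 0.\<close>

lemma Bailey_unit:
  assumes q: "q \<noteq> 0" "norm q < 1" and e: "e \<in> {0, 1}"
  shows "qconv q (\<lambda>j. (- 1) powi j * q powi int_choose_two j) N (N + e) = (if N = 0 then 1 else 0)"
proof -
  let ?a = "\<lambda>j. (- 1) powi j * q powi int_choose_two j"
  have 0: "qconv q ?a N N = (if N = 0 then 1 else 0)"
  proof (cases "N < 0")
    case False
    then obtain n where n: "N = int n" by (metis nonneg_int_cases linorder_not_less)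
    have "n > 0 \<Longrightarrow> qpoch 1 q n = 0" by (auto simp: qpoch_def intro!: bexI[of _ 0])
    then show ?thesis
      using finite_Jacobi_triple[OF q, of 1 n] n by auto
  qed (simp add: qconv_neg)
  show ?thesis
  proof (cases "e = 0")
    case False
    then have e: "e = 1" using e by simp
    show ?thesis
    proof (cases "N < 0")
      case False
      have s: "?a (j - 1) * q powi (N + j) = - (q powi (N + 1)) * ?a j" for j
      proof -
        have "?a (j - 1) * q powi (N + j) = q powi N * (?a (j - 1) * q powi j)"
          using q(1) by (simp add: power_int_add)
        also have "?a (j - 1) * q powi j = - q * ?a j"
          using theta_weight_shift_down[OF q(1), of 1 j] by simp
        finally show ?thesis using q(1) by (simp add: power_int_add)
      qed
      have "(1 - q powi (2 * N + 1)) * qconv q ?a N (N + 1)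
        = qconv q ?a N N + qconv q (\<lambda>j. ?a j * q powi (N + 1 + j)) (N - 1) (N + 1)"
        using qconv_split_right[OF q, of N "N + 1" ?a] by (simp add: algebra_simps)
      also have "qconv q (\<lambda>j. ?a j * q powi (N + 1 + j)) (N - 1) (N + 1)
        = qconv q (\<lambda>j. ?a (j - 1) * q powi (N + j)) N N"
        by (subst qconv_shift[of q _ _ _ "- 1"]) simp
      also have "\<dots> = - (q powi (N + 1)) * qconv q ?a N N"
        unfolding s qconv_cmult ..
      finally have "(1 - q powi (2 * N + 1)) * qconv q ?a N (N + 1)
        = (1 - q powi (N + 1)) * (if N = 0 then 1 else 0)"
        unfolding 0 by (simp add: algebra_simps)
      then show ?thesis
        using powi_neq_one[OF q(2), of "2 * N + 1"] False e by (auto split: if_splits)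
    qed (simp add: qconv_neg e)
  qed (simp add: 0)
qed

lemma finite_Rogers_Ramanujan:
  assumes q: "q \<noteq> 0" "norm q < 1" and e: "e \<in> {0, 1}"
  shows "qconv q (\<lambda>s. q powi (s * s + e * s)) N 0
    = qconv q (\<lambda>j. (- 1) powi j * q powi (int_choose_two j + 2 * (j * j + e * j))) N (N + e)"
proof -
  \<comment> \<open>First Bailey step: the unit \<beta> keeps only the term s = 0, so the new
    \<beta> is \<open>iqf q\<close>.\<close>
  have "iqf q N = qconv q (\<lambda>j. (- 1) powi j * q powi int_choose_two j * q powi (j * j + e * j)) N (N + e)"
    for N
  proof -
    have "(\<Sum>\<^sub>\<infinity>s. q powi (s * s + e * s) * iqf q (N - s) * (if s = 0 then 1 else 0))
      = (\<Sum>\<^sub>\<infinity>s\<in>{0}. q powi (s * s + e * s) * iqf q (N - s) * 1)"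
      by (rule infsum_cong_neutral) auto
    then show ?thesis
      using Bailey_step[OF q e Bailey_unit[OF q e, symmetric], of N] by simp
  qed
  \<comment> \<open>Second Bailey step, with \<open>iqf q\<close> as \<beta>: its left side is a
    convolution with second index 0.\<close>
  from Bailey_step[OF q e this, of N]
  have "qconv q (\<lambda>s. q powi (s * s + e * s)) N 0 = qconv q (\<lambda>j. (- 1) powi j *
      q powi int_choose_two j * q powi (j * j + e * j) * q powi (j * j + e * j)) N (N + e)"
    by (simp add: qconv_def)
  also have "(\<lambda>j. (- 1) powi j * q powi int_choose_two j * q powi (j * j + e * j) * q powi (j * j + e * j))
      = (\<lambda>j. (- 1) powi j * q powi (int_choose_two j + 2 * (j * j + e * j)))"
    using q(1) by (simp only: mult_2 power_int_add mult.assoc simp_thms)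
  finally show ?thesis .
qed

section \<open>Finite q-binomial theorem and alternating sums\<close>

text \<open>The argument of the triple product with only the left index moving, so that only the
  factors 1 - z q^N arise.\<close>

lemma q_binomial_theorem:
  assumes q: "q \<noteq> 0" "norm q < 1" and z: "z \<noteq> 0"
  shows "qconv q (\<lambda>j. (- z) powi j * q powi int_choose_two j) (int N) 0 = iqf q (int N) * qpoch z q N"
proof (induction N)
  case 0
  show ?case by (simp add: qconv_zero int_choose_two_def)
next
  case (Suc N)
  let ?a = "\<lambda>j. (- z) powi j * q powi int_choose_two j"
  let ?n = "int N"
  have s2: "?a (j + 1) * q powi (?n - j) = - (z * q ^ N) * ?a j" for j
    using theta_weight_shift[OF q(1) z, of j] q(1) by (simp add: power_int_diff)
  have "(1 - q powi (?n + 1)) * qconv q ?a (?n + 1) 0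
      = qconv q ?a ?n 0 + qconv q (\<lambda>j. ?a j * q powi (?n + 1 - j)) (?n + 1) (- 1)"
    using qconv_split_left[OF q, of "?n + 1" 0 ?a] by (simp add: algebra_simps)
  also have "qconv q (\<lambda>j. ?a j * q powi (?n + 1 - j)) (?n + 1) (- 1)
      = qconv q (\<lambda>j. ?a (j + 1) * q powi (?n - j)) ?n 0"
    by (subst qconv_shift[of q _ _ _ 1]) simp
  also have "\<dots> = - (z * q ^ N) * qconv q ?a ?n 0"
    unfolding s2 qconv_cmult ..
  finally have "(1 - q powi (?n + 1)) * qconv q ?a (?n + 1) 0
      = (1 - z * q ^ N) * (iqf q ?n * qpoch z q N)"
    unfolding Suc by (simp add: algebra_simps)
  also have "iqf q ?n = (1 - q powi (?n + 1)) * iqf q (?n + 1)"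
    using iqf_pred[OF q(2), of "?n + 1"] by simp
  finally show ?case
    using powi_neq_one[OF q(2), of "?n + 1"] by (simp add: qpoch_Suc add_ac)
qed

text \<open>With \<open>G\<close> on the diagonal and \<open>P\<close> one step below it, two
  half-steps give (1 - q^(2K+2)) G(K+1) = P(K+1) = G(K), which is the recurrence of 1 /
  (q^2;q^2)_K.\<close>

lemma qconv_Gauss:
  assumes q: "q \<noteq> 0" "norm q < 1"
  shows "qconv q (\<lambda>j. (- 1) powi j * q powi (j * j)) (int K) (int K) = 1 / qpoch (q\<^sup>2) (q\<^sup>2) K"
proof -
  let ?a = "\<lambda>j. (- 1) powi j * q powi (j * j)"
  define G P where "G K = qconv q ?a K K" and "P K = qconv q ?a K (K - 1)" for K
  have GP: "(1 - q powi (2 * K)) * G K = P K" for K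
  proof -
    let ?b = "\<lambda>j. ?a j * q powi (K + j)"
    \<comment> \<open>The remainder of the split is antisymmetric under j -> -j - 1, which preserves
      its range, so it vanishes.\<close>
    have b: "?b (- j - 1) = (- 1) * ?b j" for j
    proof -
      have "(- 1 :: complex) powi (- j - 1) = - ((- 1) powi j)"
        by (simp add: power_int_minus_left)
      moreover have "(- j - 1) * (- j - 1) + (K + (- j - 1)) = j * j + (K + j)"
        by (simp add: algebra_simps)
      then have "q powi ((- j - 1) * (- j - 1)) * q powi (K + (- j - 1)) = q powi (j * j) * q powi (K + j)"
        using q(1) by (simp only: power_int_add[symmetric] simp_thms)
      ultimately show ?thesis by (simp add: mult.assoc)
    qed
    have "qconv q ?b (K - 1) K = qconv q (\<lambda>j. ?b (- j - 1)) (K - 1) K"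
      by (subst qconv_reflect, subst qconv_shift[of q _ _ _ 1]) simp
    also have "\<dots> = - qconv q ?b (K - 1) K"
      unfolding b qconv_cmult by simp
    finally have "qconv q ?b (K - 1) K = 0" by simp
    then show ?thesis
      using qconv_split_right[OF q, of K K ?a] by (simp add: G_def P_def)
  qed
  have PG: "P (K + 1) = G K" if "K \<ge> 0" for K
  proof -
    \<comment> \<open>Here the remainder is -q (G - P), and the previous half-step turns G - P into
      q^(2K) G; the total (1 - q^(2K+1)) G cancels the factor on the left.\<close>
    have a: "?a (j + 1) * q powi (K - j) = (- q) * (?a j * q powi (K + j))" for j
    proof -
      have "(j + 1) * (j + 1) + (K - j) = 1 + (j * j + (K + j))"
        by (simp add: algebra_simps)
      then have "q powi ((j + 1) * (j + 1)) * q powi (K - j) = q powi 1 * (q powi (j * j) * q powi (K + j))"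
        using q(1) by (simp only: power_int_add[symmetric] simp_thms)
      then show ?thesis by (simp add: neg_one_powi_add1 mult_ac)
    qed
    have "(1 - q powi (2 * K + 1)) * P (K + 1)
       = G K + qconv q (\<lambda>j. ?a j * q powi (K + 1 - j)) (K + 1) (K - 1)"
      using qconv_split_left[OF q, of "K + 1" K ?a] by (simp add: G_def P_def algebra_simps)
    also have "qconv q (\<lambda>j. ?a j * q powi (K + 1 - j)) (K + 1) (K - 1)
       = qconv q (\<lambda>j. ?a (j + 1) * q powi (K - j)) K K"
      by (subst qconv_shift[of q _ _ _ 1]) simp
    also have "\<dots> = - q * (G K - P K)"
      unfolding a qconv_cmult qconv_weight_right[OF q(2)] G_def P_def ..
    also have "G K - P K = q powi (2 * K) * G K"
      unfolding GP[symmetric] by (simp add: algebra_simps)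
    also have "G K + - q * (q powi (2 * K) * G K) = (1 - q powi (2 * K + 1)) * G K"
      using q(1) by (simp add: power_int_add algebra_simps)
    finally show ?thesis
      using powi_neq_one[OF q(2), of "2 * K + 1"] that by simp
  qed
  have "G (int K) = 1 / qpoch (q\<^sup>2) (q\<^sup>2) K"
  proof (induction K)
    case 0
    show ?case by (simp add: G_def qconv_zero)
  next
    case (Suc K)
    have "(1 - q powi (2 * (int K + 1))) * G (int K + 1) = 1 / qpoch (q\<^sup>2) (q\<^sup>2) K"
      using GP[of "int K + 1"] PG[of "int K"] Suc by simp
    moreover have "q powi (2 * (int K + 1)) = q\<^sup>2 * (q\<^sup>2) ^ K"
      using q(1) by (simp add: power_int_add power_int_mult ring_distribs power_mult)
    moreover have "1 - q powi (2 * (int K + 1)) \<noteq> 0"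
      by (rule powi_neq_one[OF q(2)]) simp
    ultimately show ?case
      using eq_inverse_of_mult by (metis qpoch_Suc of_nat_Suc add.commute)
  qed
  then show ?thesis by (simp add: G_def)
qed

text \<open>The flip j -> N - j reverses every sign when N is odd, so the sum equals its own
  negative.\<close>

lemma qconv_alternating_odd:
  "odd N \<Longrightarrow> qconv q (\<lambda>j. (- 1) powi j) N 0 = 0"
proof -
  assume "odd N"
  then have "(- 1 :: complex) powi (N - j) = (- 1) * (- 1) powi j" for j
    by (auto simp: power_int_minus_left)
  then have "qconv q (\<lambda>j. (- 1) powi j) N 0 = - qconv q (\<lambda>j. (- 1) powi j) N 0"
    by (subst qconv_flip) (simp add: qconv_cmult[of q "-1", simplified])
  then show ?thesis by simp
qed

text \<open>In the split at M + 1 the remainder is minus the difference of the sums at M and M - 1.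
  The sum at M cancels, which links M + 1 directly to M - 1.\<close>

lemma qconv_alternating_even:
  assumes q: "q \<noteq> 0" "norm q < 1"
  shows "qconv q (\<lambda>j. (- 1) powi j) (2 * int k) 0 = 1 / qpoch (q\<^sup>2) (q\<^sup>2) k"
proof (induction k)
  case 0
  show ?case by (simp add: qconv_zero)
next
  case (Suc k)
  define M where "M = 2 * int k + 1"
  let ?a = "\<lambda>j. (- 1 :: complex) powi j"
  have "(1 - q powi (M + 1)) * qconv q ?a (M + 1) 0
      = qconv q ?a M 0 + qconv q (\<lambda>j. ?a j * q powi (M + 1 - j)) (M + 1) (- 1)"
    using qconv_split_left[OF q, of "M + 1" 0 ?a] by simp
  also have "qconv q (\<lambda>j. ?a j * q powi (M + 1 - j)) (M + 1) (- 1)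
      = qconv q (\<lambda>j. (- 1) * (?a j * q powi (M - j))) M 0"
    by (subst qconv_shift[of q _ _ _ 1]) (simp add: neg_one_powi_add1)
  also have "\<dots> = - (qconv q ?a M 0 - qconv q ?a (M - 1) 0)"
    unfolding qconv_cmult qconv_weight_left[OF q(2)] by simp
  finally have "(1 - q powi (M + 1)) * qconv q ?a (M + 1) 0 = 1 / qpoch (q\<^sup>2) (q\<^sup>2) k"
    using Suc by (simp add: M_def)
  moreover have "q powi (M + 1) = q\<^sup>2 * (q\<^sup>2) ^ k"
    using q(1) by (simp add: M_def power_int_add power_int_mult power2_eq_square power_mult)
  moreover have "1 - q powi (M + 1) \<noteq> 0"
    by (rule powi_neq_one[OF q(2)]) (simp add: M_def)
  moreover have "2 * int (Suc k) = M + 1" by (simp add: M_def)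
  ultimately show ?case
    using eq_inverse_of_mult by (metis qpoch_Suc)
qed

text \<open>Splitting in base q^2 and flipping the remainder gives the factor 1 + q^(N+1), which
  cancels against 1 - q^(2N+2) and leaves the recurrence of 1 / (q;q)_N.\<close>

lemma qconv_base_square:
  assumes q: "q \<noteq> 0" "norm q < 1"
  shows "qconv (q\<^sup>2) (\<lambda>j. q powi j) (int N) 0 = iqf q (int N)"
proof (induction N)
  case 0
  show ?case by (simp add: qconv_zero)
next
  case (Suc N)
  let ?n = "int N"
  have q2: "q\<^sup>2 \<noteq> 0" "norm (q\<^sup>2) < 1"
    using q by (auto simp: norm_power power_less_one_iff)
  have p: "q\<^sup>2 powi k = q powi (2 * k)" for k
    by (simp add: power_int_power)
  have "(1 - q\<^sup>2 powi (?n + 1)) * qconv (q\<^sup>2) (\<lambda>j. q powi j) (?n + 1) 0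
      = qconv (q\<^sup>2) (\<lambda>j. q powi j) ?n 0
        + qconv (q\<^sup>2) (\<lambda>j. q powi j * q\<^sup>2 powi (?n + 1 - j)) (?n + 1) (- 1)"
    using qconv_split_left[OF q2, of "?n + 1" 0 "\<lambda>j. q powi j"] by simp
  also have "qconv (q\<^sup>2) (\<lambda>j. q powi j * q\<^sup>2 powi (?n + 1 - j)) (?n + 1) (- 1)
      = qconv (q\<^sup>2) (\<lambda>j. q powi (2 * ?n + 1 - j)) ?n 0"
    using q(1) by (subst qconv_shift[of _ _ _ _ 1]) (simp add: p power_int_add[symmetric] algebra_simps)
  also have "\<dots> = qconv (q\<^sup>2) (\<lambda>j. q powi (?n + 1) * q powi j) ?n 0"
    using q(1) by (subst qconv_flip) (simp add: power_int_add[symmetric] algebra_simps)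
  also have "\<dots> = q powi (?n + 1) * qconv (q\<^sup>2) (\<lambda>j. q powi j) ?n 0"
    by (rule qconv_cmult)
  also have "q\<^sup>2 powi (?n + 1) = (q powi (?n + 1))\<^sup>2"
    by (simp add: p power_int_power' mult.commute)
  finally have *: "(1 - (q powi (?n + 1))\<^sup>2) * qconv (q\<^sup>2) (\<lambda>j. q powi j) (?n + 1) 0
      = (1 + q powi (?n + 1)) * iqf q ?n"
    unfolding Suc by (simp add: algebra_simps)
  have "iqf q ?n = (1 - q powi (?n + 1)) * iqf q (?n + 1)"
    using iqf_pred[OF q(2), of "?n + 1"] by simp
  with * have "(1 - (q powi (?n + 1))\<^sup>2) * qconv (q\<^sup>2) (\<lambda>j. q powi j) (?n + 1) 0
      = (1 - (q powi (?n + 1))\<^sup>2) * iqf q (?n + 1)"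
    by (simp add: power2_eq_square algebra_simps)
  moreover have "1 - (q powi (?n + 1))\<^sup>2 \<noteq> 0"
    using powi_neq_one[OF q2(2), of "?n + 1"] by (simp add: p power_int_power' mult.commute)
  ultimately show ?case by (simp add: add_ac)
qed

section \<open>Limits and the Rogers--Ramanujan identities\<close>

lemma geometric_int_summable:
  fixes \<rho> :: real
  assumes "0 \<le> \<rho>" "\<rho> < 1"
  shows "(\<lambda>j::int. \<rho> powi \<bar>j\<bar>) summable_on UNIV"
proof -
  have geo: "(\<lambda>n. \<rho> ^ n) summable_on UNIV"
    using assms by (intro summable_nonneg_imp_summable_on) (auto simp: summable_geometric)
  have "(\<lambda>j::int. \<rho> powi \<bar>j\<bar>) summable_on range int"
    using geo by (subst summable_on_reindex) (auto simp: o_def)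
  moreover have "(\<lambda>j::int. \<rho> powi \<bar>j\<bar>) summable_on range (\<lambda>n. - int n)"
    using geo by (subst summable_on_reindex) (auto simp: o_def inj_def)
  ultimately have "(\<lambda>j::int. \<rho> powi \<bar>j\<bar>) summable_on range int \<union> range (\<lambda>n. - int n)"
    by (rule summable_on_union)
  moreover have "j \<in> range int \<union> range (\<lambda>n. - int n)" for j :: int
    by (cases j rule: int_cases2) auto
  then have "range int \<union> range (\<lambda>n. - int n) = UNIV" by blast
  ultimately show ?thesis by simp
qed

lemma powi_abs_summable:
  fixes q :: complex
  assumes "q \<noteq> 0" "norm q < 1" and E: "\<And>j. E j \<ge> \<bar>j\<bar> - m"
  shows "(\<lambda>j::int. norm (q powi E j)) summable_on UNIV"
proof (rule summable_on_comparison_test)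
  show "(\<lambda>j. norm q powi (- m) * norm q powi \<bar>j\<bar>) summable_on UNIV"
    using assms by (intro summable_on_cmult_right geometric_int_summable) auto
  fix j
  have "norm (q powi E j) \<le> norm q powi (\<bar>j\<bar> - m)"
    unfolding norm_power_int using assms by (intro power_int_decreasing) auto
  also have "\<dots> = norm q powi (- m) * norm q powi \<bar>j\<bar>"
    using assms by (simp add: power_int_add[symmetric])
  finally show "norm (q powi E j) \<le> norm q powi (- m) * norm q powi \<bar>j\<bar>" .
qed auto

text \<open>The quadratic exponent of q outgrows the linear growth of the exponent of z, once |z| is
  measured in powers of |q|.\<close>

lemma theta_abs_summable:
  fixes q z :: complex
  assumes q: "q \<noteq> 0" "norm q < 1" and z: "z \<noteq> 0"
  shows "(\<lambda>j. norm ((- z) powi j * q powi int_choose_two j)) summable_on UNIV"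
proof -
  have "min (norm z) (inverse (norm z)) > 0" using z by auto
  \<comment> \<open>This choice bounds both |z| and 1/|z| by |q|^(-m), which covers both signs of
    j.\<close>
  then obtain m where m: "norm q ^ m < min (norm z) (inverse (norm z))"
    using real_arch_pow_inv q(2) by blast
  have zj: "norm z powi j \<le> norm q powi (- (int m * \<bar>j\<bar>))" for j
  proof -
    have bound: "x powi \<bar>j\<bar> \<le> norm q powi (- (int m * \<bar>j\<bar>))"
      if "x \<ge> 0" "norm q ^ m \<le> inverse x" for x :: real
    proof -
      have "x \<le> inverse (norm q ^ m)"
        using that q(1) by (metis inverse_inverse_eq le_imp_inverse_le zero_less_norm_iff zero_less_power)
      then have "x powi \<bar>j\<bar> \<le> inverse (norm q ^ m) powi \<bar>j\<bar>"
        using that by (intro power_int_mono) auto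
      also have "\<dots> = norm q powi (- (int m * \<bar>j\<bar>))"
        by (simp add: power_int_inverse power_int_power power_int_minus)
      finally show ?thesis .
    qed
    show ?thesis
    proof (cases "j \<ge> 0")
      case True
      then show ?thesis using bound[of "norm z"] m by simp
    next
      case False
      then show ?thesis using bound[of "inverse (norm z)"] m
        by (simp add: power_int_inverse power_int_minus[symmetric])
    qed
  qed
  \<comment> \<open>The constant comes from doubling the inequality and completing the square around
    |j| = m + 2.\<close>
  have E: "int_choose_two j - int m * \<bar>j\<bar> \<ge> \<bar>j\<bar> - (int m + 2)\<^sup>2" for j
  proof -
    define x where "x = \<bar>j\<bar>"
    have "2 * int_choose_two j = x * x - j"
      unfolding int_choose_two_double x_def abs_mult_self_eq by (simp add: algebra_simps)
    moreover have "j \<le> x" by (simp add: x_def)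
    moreover have "x * x - x - 2 * int m * x - (2 * x - 2 * (int m + 2)\<^sup>2)
        = (x - (int m + 2))\<^sup>2 + x + (int m + 2)\<^sup>2"
      by (simp add: power2_eq_square algebra_simps)
    moreover have "(x - (int m + 2))\<^sup>2 + x + (int m + 2)\<^sup>2 \<ge> 0"
      by (simp add: x_def)
    ultimately show ?thesis
      unfolding x_def[symmetric] by linarith
  qed
  have "(\<lambda>j. norm (q powi (int_choose_two j - int m * \<bar>j\<bar>))) summable_on UNIV"
    by (rule powi_abs_summable[OF q E])
  then show ?thesis
  proof (rule summable_on_comparison_test)
    fix j
    have "norm ((- z) powi j * q powi int_choose_two j) = norm z powi j * norm q powi int_choose_two j"
      by (simp add: norm_mult norm_power_int)
    also have "\<dots> \<le> norm q powi (- (int m * \<bar>j\<bar>)) * norm q powi int_choose_two j"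
      by (intro mult_right_mono zj) simp
    also have "\<dots> = norm (q powi (int_choose_two j - int m * \<bar>j\<bar>))"
      using q(1) by (simp add: norm_power_int power_int_add[symmetric])
    finally show "norm ((- z) powi j * q powi int_choose_two j)
      \<le> norm (q powi (int_choose_two j - int m * \<bar>j\<bar>))" .
  qed auto
qed

text \<open>Both \<open>iqf\<close> factors tend to 1 / (q;q)_\<infinity> and are uniformly bounded,
  so a constant multiple of |a j| dominates. In \<open>qconv_row_tendsto\<close> only the left
  factor moves.\<close>

lemma qconv_diagonal_tendsto:
  assumes q: "norm q < 1" and a: "(\<lambda>j. norm (a j)) summable_on UNIV"
  shows "(\<lambda>N. qconv q a (int N) (int N + e)) \<longlonglongrightarrow> infsum a UNIV / (qpoch_inf q q)\<^sup>2"
proof -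
  obtain C where C: "C > 0" "\<And>k. norm (iqf q k) \<le> C" using iqf_bounded[OF q] by blast
  have "(\<lambda>N. \<Sum>\<^sub>\<infinity>j. a j * iqf q (int N - j) * iqf q (int N + e + j))
     \<longlonglongrightarrow> (\<Sum>\<^sub>\<infinity>j. a j * (1 / qpoch_inf q q) * (1 / qpoch_inf q q))"
  proof (rule tendsto_infsum_dominated[where M = "\<lambda>j. norm (a j) * (C * C)"])
    show "(\<lambda>N. a j * iqf q (int N - j) * iqf q (int N + e + j))
      \<longlonglongrightarrow> a j * (1 / qpoch_inf q q) * (1 / qpoch_inf q q)" for j
      using iqf_tendsto[OF q, of "- j"] iqf_tendsto[OF q, of "e + j"]
      by (intro tendsto_mult tendsto_const) (simp_all add: add.assoc)
    show "norm (a j * iqf q (int N - j) * iqf q (int N + e + j)) \<le> norm (a j) * (C * C)" for N j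
      unfolding norm_mult mult.assoc using C by (intro mult_left_mono mult_mono) auto
    show "(\<lambda>j. norm (a j) * (C * C)) summable_on UNIV"
      by (intro summable_on_cmult_left a)
  qed
  also have "(\<Sum>\<^sub>\<infinity>j. a j * (1 / qpoch_inf q q) * (1 / qpoch_inf q q)) = infsum a UNIV / (qpoch_inf q q)\<^sup>2"
    by (simp add: infsum_cmult_left' power2_eq_square divide_inverse mult.assoc)
  finally show ?thesis by (simp add: qconv_def)
qed

lemma qconv_row_tendsto:
  assumes q: "norm q < 1" and a: "(\<lambda>j. norm (a j)) summable_on UNIV"
  shows "(\<lambda>N. qconv q a (int N) 0) \<longlonglongrightarrow> (\<Sum>\<^sub>\<infinity>j. a j * iqf q j) / qpoch_inf q q"
proof -
  obtain C where C: "C > 0" "\<And>k. norm (iqf q k) \<le> C" using iqf_bounded[OF q] by blast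
  have "(\<lambda>N. \<Sum>\<^sub>\<infinity>j. a j * iqf q (int N - j) * iqf q j)
     \<longlonglongrightarrow> (\<Sum>\<^sub>\<infinity>j. a j * (1 / qpoch_inf q q) * iqf q j)"
  proof (rule tendsto_infsum_dominated[where M = "\<lambda>j. norm (a j) * (C * C)"])
    show "(\<lambda>N. a j * iqf q (int N - j) * iqf q j) \<longlonglongrightarrow> a j * (1 / qpoch_inf q q) * iqf q j" for j
      using iqf_tendsto[OF q, of "- j"] by (intro tendsto_mult tendsto_const) simp_all
    show "norm (a j * iqf q (int N - j) * iqf q j) \<le> norm (a j) * (C * C)" for N j
      unfolding norm_mult mult.assoc using C by (intro mult_left_mono mult_mono) auto
    show "(\<lambda>j. norm (a j) * (C * C)) summable_on UNIV"
      by (intro summable_on_cmult_left a)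
  qed
  also have "(\<lambda>j. a j * (1 / qpoch_inf q q) * iqf q j) = (\<lambda>j. a j * iqf q j * (1 / qpoch_inf q q))"
    by (simp add: mult_ac)
  also have "infsum \<dots> UNIV = (\<Sum>\<^sub>\<infinity>j. a j * iqf q j) / qpoch_inf q q"
    by (subst infsum_cmult_left') simp
  finally show ?thesis by (simp add: qconv_def)
qed

text \<open>\<open>iqf\<close> vanishes at negative integers, so the bilateral sum is really a
  series over the naturals.\<close>

lemma has_sum_div_qpoch:
  assumes q: "norm q < 1" and a: "(\<lambda>j. norm (a j)) summable_on UNIV"
  shows "((\<lambda>n. a (int n) / qpoch q q n) has_sum (\<Sum>\<^sub>\<infinity>j. a j * iqf q j)) UNIV"
proof -
  obtain C where C: "C > 0" "\<And>k. norm (iqf q k) \<le> C" using iqf_bounded[OF q] by blast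
  have "(\<lambda>j. norm (a j * iqf q j)) summable_on UNIV"
    by (rule summable_on_comparison_test[OF summable_on_cmult_left[OF a, of C]])
       (use C in \<open>auto simp: norm_mult intro!: mult_left_mono\<close>)
  then have "((\<lambda>j. a j * iqf q j) has_sum (\<Sum>\<^sub>\<infinity>j. a j * iqf q j)) UNIV"
    by (rule has_sum_infsum[OF abs_summable_summable])
  also have "?this \<longleftrightarrow> ((\<lambda>j. a j * iqf q j) has_sum (\<Sum>\<^sub>\<infinity>j. a j * iqf q j)) (range int)"
  proof (rule has_sum_cong_neutral)
    fix j assume "j \<in> UNIV - range int"
    then have "j < 0" by (metis DiffD2 int_nat_eq linorder_not_less rangeI)
    then show "a j * iqf q j = 0" by simp
  qed auto
  also have "\<dots> \<longleftrightarrow> ((\<lambda>n. a (int n) / qpoch q q n) has_sum (\<Sum>\<^sub>\<infinity>j. a j * iqf q j)) UNIV"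
    by (subst has_sum_reindex) (auto simp: o_def iqf_of_nat)
  finally show ?thesis .
qed

section \<open>Infinite identities as limits of finite ones\<close>

text \<open>Both sides of \<open>finite_Jacobi_triple\<close> have a limit as N grows; equating the
  two limits gives the result.\<close>

theorem Jacobi_triple_product:
  assumes q: "q \<noteq> 0" "norm q < 1" and z: "z \<noteq> 0"
  shows "(\<Sum>\<^sub>\<infinity>j. (- z) powi j * q powi int_choose_two j)
    = qpoch_inf q q * qpoch_inf z q * qpoch_inf (q / z) q"
proof -
  have nz: "qpoch_inf q q \<noteq> 0" using q by (intro qpoch_inf_nonzero)
  have "(\<lambda>N. iqf q (int N + 0)) \<longlonglongrightarrow> 1 / qpoch_inf q q"
    by (rule iqf_tendsto[OF q(2)])
  then have "(\<lambda>N. iqf q (int (2 * N))) \<longlonglongrightarrow> 1 / qpoch_inf q q"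
    using LIMSEQ_subseq_LIMSEQ[of _ _ "\<lambda>n. 2 * n"] by (fastforce simp: o_def strict_mono_def)
  then have "(\<lambda>N. iqf q (2 * int N) * qpoch z q N * qpoch (q / z) q N)
      \<longlonglongrightarrow> 1 / qpoch_inf q q * qpoch_inf z q * qpoch_inf (q / z) q"
    using q(2) by (intro tendsto_mult qpoch_tendsto) simp_all
  moreover have "(\<lambda>N. iqf q (2 * int N) * qpoch z q N * qpoch (q / z) q N)
      \<longlonglongrightarrow> (\<Sum>\<^sub>\<infinity>j. (- z) powi j * q powi int_choose_two j) / (qpoch_inf q q)\<^sup>2"
    using qconv_diagonal_tendsto[OF q(2) theta_abs_summable[OF q z], of 0]
    by (simp add: finite_Jacobi_triple[OF q z])
  ultimately have "(\<Sum>\<^sub>\<infinity>j. (- z) powi j * q powi int_choose_two j) / (qpoch_inf q q)\<^sup>2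
     = 1 / qpoch_inf q q * qpoch_inf z q * qpoch_inf (q / z) q"
    by (rule LIMSEQ_unique[rotated])
  then show ?thesis using nz by (simp add: field_simps power2_eq_square)
qed

theorem Euler_q_exponential:
  assumes q: "q \<noteq> 0" "norm q < 1" and z: "z \<noteq> 0"
  shows "((\<lambda>n. (- z) ^ n * q powi int_choose_two (int n) / qpoch q q n) has_sum qpoch_inf z q) UNIV"
proof -
  have nz: "qpoch_inf q q \<noteq> 0" using q by (intro qpoch_inf_nonzero)
  let ?a = "\<lambda>j. (- z) powi j * q powi int_choose_two j"
  have a: "(\<lambda>j. norm (?a j)) summable_on UNIV" by (rule theta_abs_summable[OF q z])
  have "(\<lambda>N. iqf q (int N + 0) * qpoch z q N) \<longlonglongrightarrow> 1 / qpoch_inf q q * qpoch_inf z q"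
    using q(2) by (intro tendsto_mult qpoch_tendsto iqf_tendsto)
  moreover have "(\<lambda>N. iqf q (int N + 0) * qpoch z q N) \<longlonglongrightarrow> (\<Sum>\<^sub>\<infinity>j. ?a j * iqf q j) / qpoch_inf q q"
    using qconv_row_tendsto[OF q(2) a] by (simp add: q_binomial_theorem[OF q z])
  ultimately have "(\<Sum>\<^sub>\<infinity>j. ?a j * iqf q j) / qpoch_inf q q = 1 / qpoch_inf q q * qpoch_inf z q"
    by (rule LIMSEQ_unique[rotated])
  then have "(\<Sum>\<^sub>\<infinity>j. ?a j * iqf q j) = qpoch_inf z q" using nz by simp
  then show ?thesis using has_sum_div_qpoch[OF q(2) a] by simp
qed

text \<open>As N grows the finite identity equates the Rogers--Ramanujan series with a bilateral
  theta series. The exponent of the latter is 5 binom(j,2) + (2 + 2e) j, so the triple product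
  applies in base q^5 with z = q^(2+2e).\<close>

lemma Rogers_Ramanujan_theta:
  assumes q: "q \<noteq> 0" "norm q < 1" and e: "e \<in> {0, 1}"
  shows "((\<lambda>n. q ^ (n * n + e * n) / qpoch q q n) has_sum
    (qpoch_inf (q^5) (q^5) * qpoch_inf (q ^ (2 + 2 * e)) (q^5) * qpoch_inf (q^5 / q ^ (2 + 2 * e)) (q^5)
      / qpoch_inf q q)) UNIV"
proof -
  have nz: "qpoch_inf q q \<noteq> 0" using q by (intro qpoch_inf_nonzero)
  have q5: "q ^ 5 \<noteq> 0" "norm (q ^ 5) < 1" using q by (auto simp: norm_power power_less_one_iff)
  have z: "q ^ (2 + 2 * e) \<noteq> 0" using q by simp
  have e': "int e \<in> {0, 1}" using e by auto
  let ?a = "\<lambda>s. q powi (s * s + int e * s)"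
  let ?b = "\<lambda>j. (- 1) powi j * q powi (int_choose_two j + 2 * (j * j + int e * j))"
  have b: "?b j = (- (q ^ (2 + 2 * e))) powi j * (q ^ 5) powi int_choose_two j" for j
  proof -
    have "int_choose_two j + 2 * (j * j + int e * j) = int (2 + 2 * e) * j + 5 * int_choose_two j"
      using int_choose_two_double[of j] by (simp add: algebra_simps)
    then have "q powi (int_choose_two j + 2 * (j * j + int e * j))
        = q powi (int (2 + 2 * e) * j) * q powi (int 5 * int_choose_two j)"
      using q(1) by (simp only: power_int_add simp_thms of_nat_numeral)
    also have "\<dots> = (q ^ (2 + 2 * e)) powi j * (q ^ 5) powi int_choose_two j"
      by (simp only: power_int_power)
    finally have "q powi (int_choose_two j + 2 * (j * j + int e * j))
        = (q ^ (2 + 2 * e)) powi j * (q ^ 5) powi int_choose_two j" .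
    moreover have "(- (q ^ (2 + 2 * e))) powi j = (- 1) powi j * (q ^ (2 + 2 * e)) powi j"
      by (metis mult_minus1 power_int_mult_distrib)
    ultimately show ?thesis by simp
  qed
  have sa: "(\<lambda>j. norm (?a j)) summable_on UNIV"
  \<comment> \<open>The slack 1 covers e = 1, j = -1, where the exponent is 0.\<close>
  proof (rule powi_abs_summable[OF q, where m = 1])
    fix j :: int
    have "\<bar>i\<bar> \<le> i * i" for i :: int
      using mult_left_mono[of 1 "\<bar>i\<bar>" "\<bar>i\<bar>"] by (cases "i = 0") auto
    from this[of j] this[of "j + 1"] show "\<bar>j\<bar> - 1 \<le> j * j + int e * j"
      using e by (auto simp: algebra_simps)
  qed
  have sb: "(\<lambda>j. norm (?b j)) summable_on UNIV"
    unfolding b by (rule theta_abs_summable[OF q5 z])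
  have "(\<lambda>N. qconv q ?a (int N) 0) \<longlonglongrightarrow> (\<Sum>\<^sub>\<infinity>j. ?a j * iqf q j) / qpoch_inf q q"
    by (rule qconv_row_tendsto[OF q(2) sa])
  moreover have "(\<lambda>N. qconv q ?a (int N) 0) \<longlonglongrightarrow> (\<Sum>\<^sub>\<infinity>j. ?b j) / (qpoch_inf q q)\<^sup>2"
    unfolding finite_Rogers_Ramanujan[OF q e'] by (rule qconv_diagonal_tendsto[OF q(2) sb])
  ultimately have "(\<Sum>\<^sub>\<infinity>j. ?a j * iqf q j) / qpoch_inf q q = (\<Sum>\<^sub>\<infinity>j. ?b j) / (qpoch_inf q q)\<^sup>2"
    by (rule LIMSEQ_unique)
  then have "(\<Sum>\<^sub>\<infinity>j. ?a j * iqf q j) = (\<Sum>\<^sub>\<infinity>j. ?b j) / qpoch_inf q q"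
    using nz by (simp add: field_simps power2_eq_square)
  moreover have "?a (int n) = q ^ (n * n + e * n)" for n
    by (simp flip: of_nat_mult of_nat_add)
  ultimately show ?thesis
    using has_sum_div_qpoch[OF q(2) sa] Jacobi_triple_product[OF q5 z]
    unfolding b by (simp only:)
qed

lemma qpoch_inf_power_nonzero:
  assumes "norm q < 1" "k > 0" "l > 0"
  shows "qpoch_inf (q ^ k) (q ^ l) \<noteq> 0"
  using assms by (intro qpoch_inf_nonzero) (simp_all add: norm_power power_less_one_iff)

text \<open>In the quintisected (q;q)_\<infinity> the classes 0, 2, 3 modulo 5 cancel against the
  triple product, leaving 1 and 4.\<close>

theorem Rogers_Ramanujan_1:
  assumes q: "q \<noteq> 0" "norm q < 1"
  shows "((\<lambda>n. q ^ (n * n) / qpoch q q n) has_sum 1 / qpochs_inf [q, q ^ 4] (q ^ 5)) UNIV"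
proof -
  have e: "2 + 2 * 0 = (2::nat)" and d: "q ^ 5 / q ^ 2 = q ^ 3"
    using q by (simp_all add: field_simps eval_nat_numeral)
  have "qpoch_inf (q^5) (q^5) * qpoch_inf (q^2) (q^5) * qpoch_inf (q^3) (q^5) / qpoch_inf q q
      = 1 / qpochs_inf [q, q ^ 4] (q ^ 5)"
    using qpoch_inf_power_nonzero[OF q(2), of _ 5]
    by (simp add: qpoch_inf_quintisection[OF q(2)] qpochs_inf_def)
  then show ?thesis
    using Rogers_Ramanujan_theta[OF q, of 0, unfolded e d] by simp
qed

theorem Rogers_Ramanujan_2:
  assumes q: "q \<noteq> 0" "norm q < 1"
  shows "((\<lambda>n. q ^ (n * n + n) / qpoch q q n) has_sum 1 / qpochs_inf [q ^ 2, q ^ 3] (q ^ 5)) UNIV"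
proof -
  have e: "2 + 2 * 1 = (4::nat)" and d: "q ^ 5 / q ^ 4 = q"
    using q by (simp_all add: field_simps eval_nat_numeral)
  have "qpoch_inf (q^5) (q^5) * qpoch_inf (q^4) (q^5) * qpoch_inf q (q^5) / qpoch_inf q q
      = 1 / qpochs_inf [q ^ 2, q ^ 3] (q ^ 5)"
    using qpoch_inf_power_nonzero[OF q(2), of _ 5] qpoch_inf_power_nonzero[OF q(2), of 1 5]
    by (simp add: qpoch_inf_quintisection[OF q(2)] qpochs_inf_def)
  then show ?thesis
    using Rogers_Ramanujan_theta[OF q, of 1, unfolded e d] by simp
qed

section \<open>Double series\<close>

text \<open>The bijection (n, m) -> (n + m, m) turns antidiagonals into finite fibres; summability
  of \<open>f\<close> allows summing fibre by fibre.\<close>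

lemma has_sum_antidiagonal:
  fixes f :: "nat \<times> nat \<Rightarrow> complex"
  assumes f: "f summable_on UNIV" and g: "\<And>N. g N = (\<Sum>m\<le>N. f (N - m, m))"
  shows "(f has_sum S) UNIV \<longleftrightarrow> (g has_sum S) UNIV"
proof -
  let ?h = "\<lambda>x. f (fst x - snd x, snd x)"
  have reindex: "(f has_sum T) UNIV \<longleftrightarrow> (?h has_sum T) (SIGMA N:UNIV. {..N})" for T
    by (rule has_sum_reindex_bij_witness[of _ "\<lambda>x. (fst x - snd x, snd x)" "\<lambda>x. (fst x + snd x, snd x)"])
       auto
  have inner: "((\<lambda>m. ?h (N, m)) has_sum g N) {..N}" for N
    by (rule has_sum_finiteI) (simp_all add: g)
  have "?h summable_on (SIGMA N:UNIV. {..N})"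
    using f reindex by (auto simp: summable_on_def)
  then show ?thesis
    unfolding reindex using has_sum_SigmaD[OF _ inner] has_sum_SigmaI[OF inner] by blast
qed

lemma has_sum_even_nat:
  fixes g :: "nat \<Rightarrow> complex"
  assumes "\<And>N. odd N \<Longrightarrow> g N = 0"
  shows "(g has_sum S) UNIV \<longleftrightarrow> ((\<lambda>k. g (2 * k)) has_sum S) UNIV"
proof -
  have "(g has_sum S) UNIV \<longleftrightarrow> (g has_sum S) (range ((*) 2))"
    using assms by (intro has_sum_cong_neutral) (auto simp: image_iff elim: evenE)
  also have "\<dots> \<longleftrightarrow> ((\<lambda>k. g (2 * k)) has_sum S) UNIV"
    by (subst has_sum_reindex) (auto simp: o_def inj_def)
  finally show ?thesis .
qed

text \<open>The inverse q-factorials are bounded and the exponent is at least n + m, so a product of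
  two geometric series dominates.\<close>

lemma double_series_summable:
  fixes t p :: complex
  assumes t: "norm t < 1" and p: "norm p < 1"
    and u: "\<And>n m. norm (u n m) \<le> 1" and E: "\<And>n m. E n m \<ge> n + m"
  shows "(\<lambda>(n, m). u n m * t ^ E n m / (qpoch p p m * qpoch p p n)) summable_on (UNIV :: (nat \<times> nat) set)"
proof -
  obtain C where C: "C > 0" "\<And>k. norm (iqf p k) \<le> C" using iqf_bounded[OF p] by blast
  let ?\<rho> = "norm t"
  have "((\<lambda>n. ?\<rho> ^ n) has_sum 1 / (1 - ?\<rho>)) UNIV"
    using t by (intro sums_nonneg_imp_has_sum geometric_sums) auto
  then have geo: "((\<lambda>n. c * ?\<rho> ^ n) has_sum c * (1 / (1 - ?\<rho>))) UNIV" for c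
    by (rule has_sum_cmult_right)
  have "(\<lambda>(n, m). C * C * ?\<rho> ^ n * ?\<rho> ^ m) summable_on (UNIV \<times> UNIV :: (nat \<times> nat) set)"
  proof (rule summable_on_SigmaI)
    show "((\<lambda>m. case (n, m) of (n, m) \<Rightarrow> C * C * ?\<rho> ^ n * ?\<rho> ^ m)
        has_sum (C * C * ?\<rho> ^ n * (1 / (1 - ?\<rho>)))) UNIV" for n
      using geo[of "C * C * ?\<rho> ^ n"] by simp
    show "(\<lambda>n. C * C * ?\<rho> ^ n * (1 / (1 - ?\<rho>))) summable_on UNIV"
      by (intro summable_on_cmult_left has_sum_imp_summable[OF geo])
  qed (use C in auto)
  then have "(\<lambda>x. norm (case x of (n, m) \<Rightarrow> u n m * t ^ E n m / (qpoch p p m * qpoch p p n)))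
      summable_on (UNIV :: (nat \<times> nat) set)"
    unfolding UNIV_Times_UNIV
  proof (rule summable_on_comparison_test)
    fix x :: "nat \<times> nat"
    obtain n m where x: "x = (n, m)" by fastforce
    have "norm (u n m * t ^ E n m / (qpoch p p m * qpoch p p n))
        = norm (u n m) * ?\<rho> ^ E n m * (norm (iqf p (int m)) * norm (iqf p (int n)))"
      by (simp add: iqf_of_nat norm_mult norm_divide norm_power)
    also have "\<dots> \<le> 1 * ?\<rho> ^ (n + m) * (C * C)"
      using t u[of n m] E[of n m] C by (intro mult_mono power_decreasing) auto
    finally show "norm (case x of (n, m) \<Rightarrow> u n m * t ^ E n m / (qpoch p p m * qpoch p p n))
        \<le> (case x of (n, m) \<Rightarrow> C * C * ?\<rho> ^ n * ?\<rho> ^ m)"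
      by (simp add: x power_add mult_ac)
  qed auto
  then show ?thesis by (rule abs_summable_summable)
qed

section \<open>The two series with sign given by binom(n-m, 2)\<close>

lemma neg_one_powi_choose_two_reflect:
  "(- 1 :: complex) powi int_choose_two (- k) = (- 1) powi k * (- 1) powi int_choose_two k"
proof -
  have "int_choose_two (- k) = k + int_choose_two k"
    using int_choose_two_double[of k] int_choose_two_double[of "- k"] by (simp add: algebra_simps)
  then show ?thesis by (simp add: power_int_add)
qed

lemma neg_one_powi_choose_two_even:
  "(- 1 :: complex) powi int_choose_two (2 * k) = (- 1) powi k"
proof -
  have "int_choose_two (2 * k) = k * (2 * k - 1)"
    using int_choose_two_double[of "2 * k"] by (simp add: algebra_simps)
  then show ?thesis by (simp add: power_int_minus_left)
qed

text \<open>\<open>r\<close> is q^(1/4), and \<open>e\<close> selects the version without or with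
  the extra m + n. Antidiagonals of odd length index cancel; those with n + m = 2k are Gauss
  sums.\<close>

lemma signed_double_series:
  fixes q r :: complex
  assumes q: "q \<noteq> 0" "norm q < 1" and r: "r ^ 4 = q"
    and S: "((\<lambda>k. (q\<^sup>2) ^ (k * k + e * k) / qpoch (q\<^sup>2) (q\<^sup>2) k) has_sum S) UNIV"
  shows "((\<lambda>(n, m). (- 1) powi int_choose_two (int n - int m)
      * r ^ (3 * m\<^sup>2 + 2 * m * n + 3 * n\<^sup>2 + e * (4 * m + 4 * n))
      / (qpoch q q m * qpoch q q n)) has_sum S) UNIV"
proof -
  define w where "w n m = (- 1) powi int_choose_two (int n - int m)
      * r ^ (3 * m\<^sup>2 + 2 * m * n + 3 * n\<^sup>2 + e * (4 * m + 4 * n))" for n m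
  define f where "f = (\<lambda>(n, m). w n m / (qpoch q q m * qpoch q q n))"
  have "norm r ^ 4 < 1" using q(2) r by (metis norm_power)
  then have r1: "norm r < 1" by (simp add: power_less_one_iff)
  have r0: "r \<noteq> 0" using q(1) r by auto
  have sq: "k \<le> 3 * k\<^sup>2" for k :: nat by (cases k) (auto simp: power2_eq_square)
  have fs: "f summable_on UNIV"
    unfolding f_def w_def
  proof (rule double_series_summable[OF r1 q(2)])
    show "n + m \<le> 3 * m\<^sup>2 + 2 * m * n + 3 * n\<^sup>2 + e * (4 * m + 4 * n)" for n m
      using sq[of n] sq[of m] by linarith
  qed (simp add: norm_power_int)
  define g where "g N = (\<Sum>m\<le>N. f (N - m, m))" for N
  \<comment> \<open>Exchanging n and m preserves the exponent but changes the sign, as binom(-k,2) =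
    binom(k,2) + k with k odd.\<close>
  have odd: "g N = 0" if "odd N" for N
  proof -
    have "g N = (\<Sum>m\<le>N. f (m, N - m))"
      unfolding g_def by (rule sum.reindex_bij_witness[of _ "\<lambda>m. N - m" "\<lambda>m. N - m"]) auto
    also have "\<dots> = (\<Sum>m\<le>N. - f (N - m, m))"
    proof (rule sum.cong)
      fix m assume "m \<in> {..N}"
      then have N: "m \<le> N" by simp
      have "odd (int (N - m) - int m)" using that N by (simp add: of_nat_diff)
      then have "(- 1 :: complex) powi int_choose_two (int m - int (N - m))
          = - ((- 1) powi int_choose_two (int (N - m) - int m))"
        using neg_one_powi_choose_two_reflect[of "int (N - m) - int m"] by simp
      moreover have "3 * (N - m)\<^sup>2 + 2 * (N - m) * m + 3 * m\<^sup>2 + e * (4 * (N - m) + 4 * m)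
          = 3 * m\<^sup>2 + 2 * m * (N - m) + 3 * (N - m)\<^sup>2 + e * (4 * m + 4 * (N - m))"
        by (simp add: algebra_simps)
      ultimately have "w m (N - m) = - w (N - m) m"
        unfolding w_def by (simp only:) simp
      then show "f (m, N - m) = - f (N - m, m)" by (simp add: f_def mult.commute)
    qed simp
    also have "\<dots> = - g N" by (simp add: g_def sum_negf)
    finally show ?thesis by simp
  qed
  have even: "g (2 * k) = (q\<^sup>2) ^ (k * k + e * k) / qpoch (q\<^sup>2) (q\<^sup>2) k" for k
  proof -
    let ?K = "int k"
    define a where "a j = (q\<^sup>2) ^ (k * k + e * k) * ((- 1) powi (j - ?K) * q powi ((j - ?K) * (j - ?K)))" for j
    have "w (2 * k - m) m = a (int m)" if m: "m \<le> 2 * k" for m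
    proof -
      \<comment> \<open>With m = k + d and n = k - d, the form 3m^2 + 2mn + 3n^2 becomes 8k^2 +
        4d^2, separating the Gauss weight q^(d^2) from a constant.\<close>
      define d where "d = int m - ?K"
      have im: "int m = ?K + d" and inn: "int (2 * k - m) = ?K - d"
        using m by (simp_all add: d_def of_nat_diff)
      have "int (2 * k - m) - int m = 2 * (- d)" unfolding im inn by simp
      then have 1: "(- 1 :: complex) powi int_choose_two (int (2 * k - m) - int m) = (- 1) powi d"
        by (simp only: neg_one_powi_choose_two_even power_int_minus_one_minus)
      have "int (3 * m\<^sup>2 + 2 * m * (2 * k - m) + 3 * (2 * k - m)\<^sup>2 + e * (4 * m + 4 * (2 * k - m)))
        = 4 * (2 * int (k * k + e * k) + d * d)"
        unfolding of_nat_add of_nat_mult of_nat_power im inn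
        by (simp add: power2_eq_square algebra_simps)
      then have "r ^ (3 * m\<^sup>2 + 2 * m * (2 * k - m) + 3 * (2 * k - m)\<^sup>2 + e * (4 * m + 4 * (2 * k - m)))
        = r powi (4 * (2 * int (k * k + e * k) + d * d))"
        by (metis power_int_of_nat)
      also have "\<dots> = q powi (2 * int (k * k + e * k) + d * d)"
        unfolding r[symmetric] power_int_power by simp
      also have "\<dots> = q powi (2 * int (k * k + e * k)) * q powi (d * d)"
        using q(1) by (intro power_int_add) simp
      also have "q powi (2 * int (k * k + e * k)) = (q\<^sup>2) ^ (k * k + e * k)"
        by (metis power_int_of_nat power_int_power of_nat_numeral)
      finally show ?thesis
        unfolding w_def a_def 1 d_def[symmetric] by (simp only: mult_ac)
    qed
    then have "g (2 * k) = (\<Sum>m\<le>2 * k. a (int m) / (qpoch q q m * qpoch q q (2 * k - m)))"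
      unfolding g_def f_def by (intro sum.cong) auto
    also have "\<dots> = qconv q a (int (2 * k)) 0"
      by (rule qconv_conv_sum[symmetric])
    also have "\<dots> = qconv q (\<lambda>j. (q\<^sup>2) ^ (k * k + e * k) * ((- 1) powi j * q powi (j * j))) ?K ?K"
      by (subst qconv_shift[of q _ _ _ ?K]) (simp add: a_def)
    also have "\<dots> = (q\<^sup>2) ^ (k * k + e * k) / qpoch (q\<^sup>2) (q\<^sup>2) k"
      unfolding qconv_cmult qconv_Gauss[OF q] by simp
    finally show ?thesis .
  qed
  have "(g has_sum S) UNIV"
    by (subst has_sum_even_nat) (use odd S in \<open>simp_all add: even\<close>)
  then have "(f has_sum S) UNIV"
    using has_sum_antidiagonal[OF fs g_def] by blast
  then show ?thesis unfolding f_def w_def .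
qed

section \<open>The two series with sign (-1)^m\<close>

lemma qpoch_mult_neg: "qpoch a q n * qpoch (- a) q n = qpoch (a\<^sup>2) (q\<^sup>2) n"
  by (induction n) (simp_all add: qpoch_Suc algebra_simps power2_eq_square power_mult_distrib)

text \<open>One double series is summed in two ways: along antidiagonals it gives the
  Rogers--Ramanujan terms, and along rows Euler's theorem gives the target terms times
  (-q^2;q^2)_\<infinity>.\<close>

lemma Rogers_transformation:
  assumes q: "q \<noteq> 0" "norm q < 1" and e: "e \<in> {0, 1}"
    and S: "((\<lambda>n. q ^ (n * n + e * n) / qpoch q q n) has_sum S) UNIV"
  shows "((\<lambda>k. q ^ (k * k + 2 * e * k) / qpoch ((q\<^sup>2)\<^sup>2) ((q\<^sup>2)\<^sup>2) k)
    has_sum (S / qpoch_inf (- (q\<^sup>2)) (q\<^sup>2))) UNIV"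
proof -
  define p where "p = q\<^sup>2"
  have p: "p \<noteq> 0" "norm p < 1"
    using q by (auto simp: p_def norm_power power_less_one_iff)
  \<comment> \<open>The bracket is the exponent of q in the j-th term of Euler's expansion of
    (-q^(2k+2);q^2)_\<infinity>.\<close>
  define E where "E k j = k * k + 2 * e * k + (j * j + j + 2 * k * j)" for k j :: nat
  define h where "h = (\<lambda>(k, j). 1 * q ^ E k j / (qpoch p p j * qpoch p p k))"
  have "k + j \<le> E k j" for k j
    unfolding E_def by (cases k) auto
  then have hs: "h summable_on UNIV"
    unfolding h_def by (intro double_series_summable[OF q(2) p(2)]) simp_all
  have diag: "(\<Sum>j\<le>N. h (N - j, j)) = q ^ (N * N + e * N) / qpoch q q N" for N
  proof -
    \<comment> \<open>For k + j = N the exponent exceeds N^2 + e N by j if e = 0 and by k if e = 1;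
      the flip identifies the two cases.\<close>
    define b where "b j = (if e = 0 then q powi j else q powi (int N - j))" for j
    have "q ^ E (N - j) j = q ^ (N * N + e * N) * b (int j)" if j: "j \<le> N" for j
    proof -
      obtain k where k: "N = k + j" using j by (metis le_add_diff_inverse2)
      have "E k j = N * N + e * N + (if e = 0 then j else k)"
        using e by (auto simp: E_def k algebra_simps)
      then show ?thesis
        by (simp add: k b_def power_add)
    qed
    then have "(\<Sum>j\<le>N. h (N - j, j))
        = (\<Sum>j\<le>N. q ^ (N * N + e * N) * b (int j) / (qpoch p p j * qpoch p p (N - j)))"
      unfolding h_def by (intro sum.cong) auto
    also have "\<dots> = qconv p (\<lambda>j. q ^ (N * N + e * N) * b j) (int N) 0"
      by (rule qconv_conv_sum[symmetric])
    also have "\<dots> = q ^ (N * N + e * N) * qconv p b (int N) 0"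
      by (rule qconv_cmult)
    also have "qconv p b (int N) 0 = qconv p (\<lambda>j. q powi j) (int N) 0"
    proof (cases "e = 0")
      case False
      then show ?thesis by (subst qconv_flip) (simp add: b_def)
    qed (simp add: b_def[abs_def])
    also have "\<dots> = 1 / qpoch q q N"
      unfolding p_def qconv_base_square[OF q] by (rule iqf_of_nat)
    finally show ?thesis by simp
  qed
  have "(h has_sum S) (UNIV \<times> UNIV)"
    using has_sum_antidiagonal[OF hs diag[symmetric]] S by simp
  moreover have "((\<lambda>j. h (k, j)) has_sum
      qpoch_inf (- p) p * (q ^ (k * k + 2 * e * k) / qpoch (p\<^sup>2) (p\<^sup>2) k)) UNIV" for k
  proof -
    have "h (k, j) = q ^ (k * k + 2 * e * k) / qpoch p p k *
        ((- (- p * p ^ k)) ^ j * p powi int_choose_two (int j) / qpoch p p j)" for j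
    proof -
      have "2 * int_choose_two (int j) = int j * int j - int j"
        unfolding int_choose_two_double by (simp add: algebra_simps)
      then have "int 2 * int_choose_two (int j) + int (2 * j) = int (j * j + j)" by simp
      moreover have "p powi int_choose_two (int j) * p ^ j
          = q powi (int 2 * int_choose_two (int j) + int (2 * j))"
        using q(1) unfolding p_def power_int_power power_mult[symmetric]
        by (simp only: power_int_add power_int_of_nat simp_thms)
      ultimately have "p powi int_choose_two (int j) * p ^ j = q ^ (j * j + j)"
        by (simp only: power_int_of_nat)
      moreover have "(- (- p * p ^ k)) ^ j = p ^ j * q ^ (2 * k * j)"
        by (simp add: p_def power_mult_distrib power_mult)
      moreover have "q ^ E k j = q ^ (k * k + 2 * e * k) * (q ^ (j * j + j) * q ^ (2 * k * j))"
        by (simp add: E_def power_add)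
      ultimately show ?thesis by (simp add: h_def mult_ac)
    qed
    moreover have "((\<lambda>j. (- (- p * p ^ k)) ^ j * p powi int_choose_two (int j) / qpoch p p j)
        has_sum qpoch_inf (- p * p ^ k) p) UNIV"
      using p by (intro Euler_q_exponential) auto
    ultimately have "((\<lambda>j. h (k, j)) has_sum
        q ^ (k * k + 2 * e * k) / qpoch p p k * qpoch_inf (- p * p ^ k) p) UNIV"
      by (simp only: has_sum_cmult_right)
    moreover have "qpoch_inf (- p) p = qpoch (- p) p k * qpoch_inf (- p * p ^ k) p"
      by (rule qpoch_inf_split[OF p(2)])
    moreover have "qpoch (- p) p k \<noteq> 0"
      using p by (intro qpoch_nonzero) auto
    ultimately show ?thesis
      by (simp add: qpoch_mult_neg[symmetric] mult.commute)
  qed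
  ultimately have "((\<lambda>k. qpoch_inf (- p) p * (q ^ (k * k + 2 * e * k) / qpoch (p\<^sup>2) (p\<^sup>2) k)) has_sum S) UNIV"
    by (rule has_sum_SigmaD)
  moreover have "qpoch_inf (- p) p \<noteq> 0"
    using p by (intro qpoch_inf_nonzero) auto
  ultimately show ?thesis
    unfolding p_def using has_sum_cmult_right_iff by blast
qed

text \<open>The exponent depends only on N = n + m, being N^2 + 4 e N, so each antidiagonal reduces
  to the plain alternating convolution in base q^2.\<close>

lemma alternating_double_series:
  fixes q r :: complex
  assumes q: "q \<noteq> 0" "norm q < 1" and r: "r ^ 4 = q"
    and S: "((\<lambda>k. q ^ (k * k + 2 * e * k) / qpoch ((q\<^sup>2)\<^sup>2) ((q\<^sup>2)\<^sup>2) k) has_sum S) UNIV"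
  shows "((\<lambda>(n, m). (- 1) ^ m * r ^ (m\<^sup>2 + 2 * m * n + n\<^sup>2 + e * (4 * m + 4 * n))
      / (qpoch (q\<^sup>2) (q\<^sup>2) m * qpoch (q\<^sup>2) (q\<^sup>2) n)) has_sum S) UNIV"
proof -
  define p where "p = q\<^sup>2"
  have p: "p \<noteq> 0" "norm p < 1"
    using q by (auto simp: p_def norm_power power_less_one_iff)
  define f where "f = (\<lambda>(n, m). (- 1) ^ m * r ^ (m\<^sup>2 + 2 * m * n + n\<^sup>2 + e * (4 * m + 4 * n))
      / (qpoch p p m * qpoch p p n))"
  have "norm r ^ 4 < 1" using q(2) r by (metis norm_power)
  then have r1: "norm r < 1" by (simp add: power_less_one_iff)
  have sq: "k \<le> k\<^sup>2" for k :: nat by (cases k) (auto simp: power2_eq_square)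
  have fs: "f summable_on UNIV"
    unfolding f_def
  proof (rule double_series_summable[OF r1 p(2)])
    show "n + m \<le> m\<^sup>2 + 2 * m * n + n\<^sup>2 + e * (4 * m + 4 * n)" for n m
      using sq[of n] sq[of m] by linarith
  qed (simp add: norm_power)
  define g where "g N = (\<Sum>m\<le>N. f (N - m, m))" for N
  have g: "g N = r ^ (N\<^sup>2 + 4 * e * N) * qconv p (\<lambda>j. (- 1) powi j) (int N) 0" for N
  proof -
    have "m\<^sup>2 + 2 * m * (N - m) + (N - m)\<^sup>2 + e * (4 * m + 4 * (N - m)) = N\<^sup>2 + 4 * e * N"
      if m: "m \<le> N" for m
    proof -
      obtain n where "N = n + m" using m by (metis le_add_diff_inverse2)
      then show ?thesis by (simp add: power2_eq_square algebra_simps)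
    qed
    then have "g N = (\<Sum>m\<le>N. r ^ (N\<^sup>2 + 4 * e * N) * (- 1) powi (int m) / (qpoch p p m * qpoch p p (N - m)))"
      unfolding g_def f_def by (intro sum.cong) (auto simp: mult.commute)
    also have "\<dots> = qconv p (\<lambda>j. r ^ (N\<^sup>2 + 4 * e * N) * (- 1) powi j) (int N) 0"
      by (rule qconv_conv_sum[symmetric])
    finally show ?thesis by (simp only: qconv_cmult)
  qed
  have odd: "g N = 0" if "odd N" for N
    using that by (simp add: g qconv_alternating_odd)
  have even: "g (2 * k) = q ^ (k * k + 2 * e * k) / qpoch (p\<^sup>2) (p\<^sup>2) k" for k
  proof -
    have "r ^ ((2 * k)\<^sup>2 + 4 * e * (2 * k)) = q ^ (k * k + 2 * e * k)"
      unfolding r[symmetric] power_mult[symmetric]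
      by (rule arg_cong[where f = "\<lambda>x. r ^ x"]) (simp add: power2_eq_square algebra_simps)
    then show ?thesis
      using qconv_alternating_even[OF p, of k] by (simp add: g)
  qed
  have "(g has_sum S) UNIV"
    by (subst has_sum_even_nat) (use odd S in \<open>simp_all add: even p_def\<close>)
  then have "(f has_sum S) UNIV"
    using has_sum_antidiagonal[OF fs g_def] by blast
  then show ?thesis unfolding f_def p_def .
qed

section \<open>Assembly of the four identities\<close>

lemma qpoch_inf_0 [simp]: "qpoch_inf 0 q = 1"
  by (simp add: qpoch_inf_def)

text \<open>\<open>r\<close> is the chosen q^(1/4), so all exponents are multiplied by four and
  become naturals. \<open>has_sum\<close> over pairs asserts unconditional convergence along with
  the value.\<close>

theorem theorem1p1:
  fixes q r :: complex
  assumes q: "norm q < 1"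
    and r: "r ^ 4 = q"
  shows "((\<lambda>(n, m). (-1) powi int_choose_two (int n - int m)
              * r ^ (3 * m\<^sup>2 + 2 * m * n + 3 * n\<^sup>2)
              / (qpoch q q m * qpoch q q n))
          has_sum (1 / qpochs_inf [q ^ 2, q ^ 8] (q ^ 10))) (UNIV :: (nat \<times> nat) set)
    \<and> ((\<lambda>(n, m). (-1) powi int_choose_two (int n - int m)
              * r ^ (3 * m\<^sup>2 + 2 * m * n + 3 * n\<^sup>2 + 4 * m + 4 * n)
              / (qpoch q q m * qpoch q q n))
          has_sum (1 / qpochs_inf [q ^ 4, q ^ 6] (q ^ 10))) (UNIV :: (nat \<times> nat) set)
    \<and> ((\<lambda>(n, m). (-1) ^ m * r ^ (m\<^sup>2 + 2 * m * n + n\<^sup>2)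
              / (qpoch (q ^ 2) (q ^ 2) m * qpoch (q ^ 2) (q ^ 2) n))
          has_sum (1 / (qpoch_inf (- (q ^ 2)) (q ^ 2) * qpochs_inf [q, q ^ 4] (q ^ 5))))
          (UNIV :: (nat \<times> nat) set)
    \<and> ((\<lambda>(n, m). (-1) ^ m * r ^ (m\<^sup>2 + 2 * m * n + n\<^sup>2 + 4 * m + 4 * n)
              / (qpoch (q ^ 2) (q ^ 2) m * qpoch (q ^ 2) (q ^ 2) n))
          has_sum (1 / (qpoch_inf (- (q ^ 2)) (q ^ 2) * qpochs_inf [q ^ 2, q ^ 3] (q ^ 5))))
          (UNIV :: (nat \<times> nat) set)"
proof (cases "q = 0")
  case True
  then have "r = 0" using r by simp
  \<comment> \<open>The general argument needs q nonzero for integer powers; at q = 0 only the term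
    (0, 0) survives and all products are 1.\<close>
  with True show ?thesis
    by (intro conjI; intro has_sum_finite_neutralI[of "{(0, 0)}"])
       (auto simp: qpochs_inf_def int_choose_two_def)
next
  case False
  have q2: "q\<^sup>2 \<noteq> 0" "norm (q\<^sup>2) < 1"
    using False q by (auto simp: norm_power power_less_one_iff)
  note RR = Rogers_Ramanujan_1[OF False q] Rogers_Ramanujan_2[OF False q]
  note RR2 = Rogers_Ramanujan_1[OF q2] Rogers_Ramanujan_2[OF q2]
  \<comment> \<open>The product \<open>0 * k\<close> is left unevaluated so that matching determines
    \<open>e\<close>; likewise \<open>1 * k\<close> below.\<close>
  have "((\<lambda>k. (q\<^sup>2) ^ (k * k + 0 * k) / qpoch (q\<^sup>2) (q\<^sup>2) k) has_sum
      1 / qpochs_inf [q ^ 2, q ^ 8] (q ^ 10)) UNIV"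
    using RR2(1) by (simp flip: power_mult)
  note 1 = signed_double_series[OF False q r this]
  have "((\<lambda>k. (q\<^sup>2) ^ (k * k + 1 * k) / qpoch (q\<^sup>2) (q\<^sup>2) k) has_sum
      1 / qpochs_inf [q ^ 4, q ^ 6] (q ^ 10)) UNIV"
    using RR2(2) by (simp flip: power_mult)
  note 2 = signed_double_series[OF False q r this]
  have 3: "((\<lambda>k. q ^ (k * k + 2 * 0 * k) / qpoch ((q\<^sup>2)\<^sup>2) ((q\<^sup>2)\<^sup>2) k) has_sum
      1 / qpochs_inf [q, q ^ 4] (q ^ 5) / qpoch_inf (- (q ^ 2)) (q ^ 2)) UNIV"
    using RR(1) by (intro Rogers_transformation[OF False q]) simp_all
  have 4: "((\<lambda>k. q ^ (k * k + 2 * 1 * k) / qpoch ((q\<^sup>2)\<^sup>2) ((q\<^sup>2)\<^sup>2) k) has_sum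
      1 / qpochs_inf [q ^ 2, q ^ 3] (q ^ 5) / qpoch_inf (- (q ^ 2)) (q ^ 2)) UNIV"
    using RR(2) by (intro Rogers_transformation[OF False q]) simp_all
  show ?thesis
    using 1 2 alternating_double_series[OF False q r 3] alternating_double_series[OF False q r 4]
    by (simp add: mult.commute add.assoc)
qed

end
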